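(* Let $\Gamma$ be a finite group. The distribution algebra $D(R\Gamma_* )$ is isomorphic, as a ring, to the ring $\mathcal{R}_\Gamma$ of $\Gamma_*$-weighted integer-valued polynomials.
   Context: $\Gamma_*=\{c_1,\dots,c_l\}$ is the set of conjugacy classes of $\Gamma$; a class is identified with its class sum; $1\in\Gamma_*$ is the identity class; the structure constants $A_{d,e}^c\in\mathbb{Z}$ are given by $d\,e=\sum_cA_{d,e}^c\,c$ in $\mathbb{Z}\Gamma_*=Z(\mathbb{Z}\Gamma)$. **Distribution algebra.** The functor $R\mapsto R\Gamma_*$ ($R$ a commutative ring) is the affine scheme represented by $A=\mathbb{Z}[t_c:c\in\Gamma_*]$. Multiplication corresponds to the ring homomorphism $\Delta^{(\times)}:A\to A\otimes A$, $\Delta^{(\times)}(t_c)=\sum_{d,e\in\Gamma_*}A_{d,e}^c\,t_d\otimes t_e$. Let $I\subset A$ be the ideal generated by $t_1-1$ and the $t_c$ with $c\ne1$. Then $D(R\Gamma_* )=\bigcup_{n\ge0}(A/I^n)^*\subseteq A^*=\mathrm{Hom}_{\mathbb{Z}}(A,\mathbb{Z})$, i.e. the linear functionals on $A$ vanishing on some power of $I$, with multiplication $(f_1f_2)(a)=(f_1\otimes f_2)(\Delta^{(\times)}(a))$ and identity the canonical map $A\to A/I=\mathbb{Z}$. **$\mathcal{R}_\Gamma$.** Let $\mathfrak{g}=\mathbb{Q}\Gamma_*=Z(\mathbb{Q}\Gamma)$, an abelian Lie algebra, with canonical map $\iota:\mathfrak{g}\to\mathcal{U}(\mathfrak{g})$,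 and let $T:\mathfrak{g}[[x_c:c\in\Gamma_*]]\to\mathcal{U}(\mathfrak{g})[[x_c:c\in\Gamma_*]]$ apply $\iota$ coefficientwise. Define $B_{\mathbf{N}}\in\mathcal{U}(\mathfrak{g})$ for $\mathbf{N}\in\mathbb{Z}_{\ge0}^{\Gamma_*}$ by $\exp(T(\log(1+\sum_cc\,x_c)))=\sum_{\mathbf{N}}B_{\mathbf{N}}\prod_cx_c^{\mathbf{N}(c)}$, the logarithm being computed with the associative product of $\mathbb{Q}\Gamma_*$. $\mathcal{R}_\Gamma$ is the $\mathbb{Z}$-span of the $B_{\mathbf{N}}$, a subring of $\mathcal{U}(\mathfrak{g})$. *)

theory Defs
  imports
    "HOL-Library.Poly_Mapping"
    "HOL-Library.Product_Plus"
    "HOL-Algebra.Algebraic_Closure_Type"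
    "HOL-Algebra.Ideal_Product"
    "HOL-Algebra.QuotRing"
begin

text \<open>
  The finite group is a type \<open>'g\<close> of sort \<open>{finite, group_add}\<close>. The class \<open>group_add\<close> is the
  library's class of not necessarily commutative groups, written additively, so that
  \<open>'g \<Rightarrow>\<^sub>0 'r\<close> with its convolution product is the group ring: \<open>single g a * single h b =
  single (g + h) (a * b)\<close>.
\<close>

section \<open>Conjugacy classes\<close>

typedef (overloaded) 'g conj_class = "Set.range (\<lambda>g::'g::group_add. {h + g - h | h. True})"
  morphisms class_elems Abs_conj_class
  by blast

setup_lifting type_definition_conj_class

lift_definition conj_class_of :: "'g::group_add \<Rightarrow> 'g conj_class"
  is "\<lambda>g. {h + g - h | h. True}" by blast

instance conj_class :: ("{finite, group_add}") finite
proof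
  have "inj (class_elems :: 'a conj_class \<Rightarrow> 'a set)"
    by (meson class_elems_inject injI)
  then show "finite (UNIV :: 'a conj_class set)"
    by (rule finite_imageD[rotated]) simp
qed

definition class_id :: "'g::group_add conj_class" where
  "class_id = conj_class_of 0"

lemma class_elems_class_id: "class_elems class_id = {0}"
  unfolding class_id_def by transfer auto

lemma conj_self: "g \<in> {h + g - h | h. True}" for g :: "'g::group_add"
  by (auto intro!: exI[of _ 0])

lemma mem_class_elems_iff: "g \<in> class_elems c \<longleftrightarrow> c = conj_class_of g"
proof
  assume g: "g \<in> class_elems c"
  obtain g0 where c: "class_elems c = {h + g0 - h | h. True}"
    using class_elems[of c] by auto
  from g c obtain k where k: "g = k + g0 - k" by auto
  have "{h + g0 - h | h. True} = {h + g - h | h. True}"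
  proof (intro Set.set_eqI iffI)
    fix x assume "x \<in> {h + g0 - h | h. True}"
    then obtain h where "x = h + g0 - h" by auto
    then have "x = (h - k) + g - (h - k)"
      unfolding k by (simp add: algebra_simps diff_conv_add_uminus minus_add del: add_uminus_conv_diff)
    then show "x \<in> {h + g - h | h. True}" by blast
  next
    fix x assume "x \<in> {h + g - h | h. True}"
    then obtain h where "x = h + g - h" by auto
    then have "x = (h + k) + g0 - (h + k)"
      unfolding k by (simp add: algebra_simps diff_conv_add_uminus minus_add del: add_uminus_conv_diff)
    then show "x \<in> {h + g0 - h | h. True}" by blast
  qed
  then have "class_elems c = class_elems (conj_class_of g)"
    using c by (simp add: conj_class_of.rep_eq)
  then show "c = conj_class_of g"
    by (simp add: class_elems_inject)
next
  assume "c = conj_class_of g"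
  then show "g \<in> class_elems c"
    using conj_self[of g] by (simp add: conj_class_of.rep_eq)
qed

lemma conj_class_of_conj: "conj_class_of (h + g - h) = conj_class_of g"
proof -
  have "h + g - h \<in> class_elems (conj_class_of g)"
    by (auto simp: conj_class_of.rep_eq)
  then show ?thesis
    by (simp add: mem_class_elems_iff)
qed

definition class_sum :: "'g::{finite,group_add} conj_class \<Rightarrow> 'g \<Rightarrow>\<^sub>0 'r::semiring_1" where
  "class_sum c = (\<Sum>g\<in>class_elems c. Poly_Mapping.single g 1)"

lemma lookup_class_sum:
  "Poly_Mapping.lookup (class_sum c) g = (if c = conj_class_of g then 1 else 0)"
  by (simp add: class_sum_def lookup_sum lookup_single when_def mem_class_elems_iff)

lemma lookup_single_mult_left:
  "Poly_Mapping.lookup (Poly_Mapping.single h a * x) g = a * Poly_Mapping.lookup x (- h + g)"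
  for h :: "'g::group_add"
proof -
  have "Poly_Mapping.lookup (Poly_Mapping.single h a * x) g
      = (\<Sum>l. (a when h = l) * (\<Sum>q. Poly_Mapping.lookup x q when g = l + q))"
    by (simp add: lookup_mult lookup_single)
  also have "\<dots> = (\<Sum>l. (a * (\<Sum>q. Poly_Mapping.lookup x q when g = h + q)) when h = l)"
    by (rule Sum_any.cong) (auto simp: when_def)
  also have "\<dots> = a * (\<Sum>q. Poly_Mapping.lookup x q when g = h + q)"
    by simp
  also have "(\<lambda>q. Poly_Mapping.lookup x q when g = h + q) = (\<lambda>q. Poly_Mapping.lookup x q when q = - h + g)"
    by (rule ext) (auto simp: when_def algebra_simps)
  finally show ?thesis by simp
qed

lemma lookup_single_mult_right:
  "Poly_Mapping.lookup (x * Poly_Mapping.single h a) g = Poly_Mapping.lookup x (g - h) * a"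
  for h :: "'g::group_add"
proof -
  have "Poly_Mapping.lookup (x * Poly_Mapping.single h a) g
      = (\<Sum>l. Poly_Mapping.lookup x l * (\<Sum>q. (a when h = q) when g = l + q))"
    by (simp add: lookup_mult lookup_single)
  also have "\<dots> = (\<Sum>l. Poly_Mapping.lookup x l * a when l = g - h)"
  proof (rule Sum_any.cong)
    fix l
    have *: "(\<lambda>q. (a when h = q) when g = l + q) = (\<lambda>q. (a when g = l + h) when h = q)"
      by (auto simp: when_def)
    show "Poly_Mapping.lookup x l * (\<Sum>q. (a when h = q) when g = l + q)
        = (Poly_Mapping.lookup x l * a when l = g - h)"
      unfolding * by (auto simp: when_def algebra_simps)
  qed
  finally show ?thesis by simp
qed

lemma poly_mapping_sum_single:
  "x = (\<Sum>k\<in>Poly_Mapping.keys x. Poly_Mapping.single k (Poly_Mapping.lookup x k))"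
  by (rule poly_mapping_eqI) (auto simp: lookup_sum lookup_single when_def in_keys_iff)

lemma additive_eqI:
  fixes h h' :: "('k \<Rightarrow>\<^sub>0 'v::ab_group_add) \<Rightarrow> 'z::ab_group_add"
  assumes "additive h" "additive h'"
    and "\<And>k v. h (Poly_Mapping.single k v) = h' (Poly_Mapping.single k v)"
  shows "h x = h' x"
proof -
  have "h (\<Sum>k\<in>Poly_Mapping.keys x. Poly_Mapping.single k (Poly_Mapping.lookup x k))
      = h' (\<Sum>k\<in>Poly_Mapping.keys x. Poly_Mapping.single k (Poly_Mapping.lookup x k))"
    by (simp add: additive.sum[OF assms(1)] additive.sum[OF assms(2)] assms(3))
  then show ?thesis
    by (simp only: poly_mapping_sum_single[symmetric])
qed

lemma class_sum_commute_single:
  "class_sum c * Poly_Mapping.single g a = Poly_Mapping.single g a * class_sum c"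
  for a :: "'r::comm_ring_1"
proof (rule poly_mapping_eqI)
  fix k
  have "conj_class_of (- g + k) = conj_class_of (k - g)"
    using conj_class_of_conj[of g "- g + k"] by (simp add: algebra_simps)
  then show "Poly_Mapping.lookup (class_sum c * Poly_Mapping.single g a) k
    = Poly_Mapping.lookup (Poly_Mapping.single g a * class_sum c) k"
    by (simp add: lookup_single_mult_left lookup_single_mult_right lookup_class_sum)
qed

lemma class_sum_central: "class_sum c * x = x * class_sum c"
  for x :: "'g::{finite,group_add} \<Rightarrow>\<^sub>0 'r::comm_ring_1"
proof -
  have "class_sum c * (\<Sum>k\<in>Poly_Mapping.keys x. Poly_Mapping.single k (Poly_Mapping.lookup x k))
      = (\<Sum>k\<in>Poly_Mapping.keys x. Poly_Mapping.single k (Poly_Mapping.lookup x k)) * class_sum c"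
    by (simp add: sum_distrib_left sum_distrib_right class_sum_commute_single)
  then show ?thesis
    by (simp only: poly_mapping_sum_single[symmetric])
qed

definition struct_const ::
    "'g::{finite,group_add} conj_class \<Rightarrow> 'g conj_class \<Rightarrow> 'g conj_class \<Rightarrow> int" where
  "struct_const d e = (THE A. (class_sum d * class_sum e :: 'g \<Rightarrow>\<^sub>0 int)
     = (\<Sum>c\<in>UNIV. of_int (A c) * class_sum c))"

lemma lookup_class_combination:
  "Poly_Mapping.lookup (\<Sum>c\<in>UNIV. of_int (A c) * class_sum c :: 'g::{finite,group_add} \<Rightarrow>\<^sub>0 int) g
    = A (conj_class_of g)"
proof -
  have "Poly_Mapping.lookup (of_int k * x :: 'g \<Rightarrow>\<^sub>0 int) g = k * Poly_Mapping.lookup x g" for k x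
  proof -
    have "(of_int k :: 'g \<Rightarrow>\<^sub>0 int) = Poly_Mapping.single 0 k"
      using single_of_int[of k, where ?'b = int] by (metis of_int_eq_id id_apply)
    then show ?thesis
      by (simp only: lookup_single_mult_left) simp
  qed
  then show ?thesis
    by (simp add: lookup_sum lookup_class_sum if_distrib cong: if_cong)
qed

lemma struct_const_ex1:
  "\<exists>!A. (class_sum d * class_sum e :: 'g::{finite,group_add} \<Rightarrow>\<^sub>0 int)
     = (\<Sum>c\<in>UNIV. of_int (A c) * class_sum c)"
proof -
  let ?x = "class_sum d * class_sum e :: 'g \<Rightarrow>\<^sub>0 int"
  have central: "?x * Poly_Mapping.single h 1 = Poly_Mapping.single h 1 * ?x" for h
  proof -
    have "?x * Poly_Mapping.single h 1 = class_sum d * (Poly_Mapping.single h 1 * class_sum e)"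
      by (simp only: mult.assoc class_sum_commute_single)
    also have "\<dots> = Poly_Mapping.single h 1 * ?x"
      by (simp only: mult.assoc[symmetric] class_sum_commute_single)
    finally show ?thesis .
  qed
  have inv: "Poly_Mapping.lookup ?x (h + g - h) = Poly_Mapping.lookup ?x g" for g h
  proof -
    have "Poly_Mapping.lookup (?x * Poly_Mapping.single h 1) (h + g)
        = Poly_Mapping.lookup (Poly_Mapping.single h 1 * ?x) (h + g)"
      by (simp only: central)
    then show ?thesis
      by (simp only: lookup_single_mult_left lookup_single_mult_right mult_1_left mult_1_right
        minus_add_cancel)
  qed
  define A where "A c = Poly_Mapping.lookup ?x (SOME g. g \<in> class_elems c)" for c :: "'g conj_class"
  have A: "A (conj_class_of g) = Poly_Mapping.lookup ?x g" for g
  proof -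
    have "(SOME k. k \<in> class_elems (conj_class_of g)) \<in> class_elems (conj_class_of g)"
      by (rule someI[of _ g]) (simp add: mem_class_elems_iff)
    then obtain h where "(SOME k. k \<in> class_elems (conj_class_of g)) = h + g - h"
      by (auto simp: conj_class_of.rep_eq)
    then show ?thesis
      by (simp add: A_def inv)
  qed
  have surj: "\<exists>g. c = conj_class_of g" for c :: "'g conj_class"
  proof -
    obtain g where "g \<in> class_elems c"
      using class_elems[of c] conj_self by auto
    then show ?thesis by (auto simp: mem_class_elems_iff)
  qed
  show ?thesis
  proof (rule ex1I[of _ A])
    show "?x = (\<Sum>c\<in>UNIV. of_int (A c) * class_sum c)"
      by (rule poly_mapping_eqI) (simp add: lookup_class_combination A)
  next
    fix A' assume eq: "?x = (\<Sum>c\<in>UNIV. of_int (A' c) * class_sum c)"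
    show "A' = A"
    proof
      fix c :: "'g conj_class" obtain g where c: "c = conj_class_of g" using surj[of c] by auto
      have "A' c = Poly_Mapping.lookup ?x g"
        by (simp only: c eq lookup_class_combination)
      then show "A' c = A c" by (simp add: c A)
    qed
  qed
qed

lemma struct_const:
  "(class_sum d * class_sum e :: 'g::{finite,group_add} \<Rightarrow>\<^sub>0 int)
     = (\<Sum>c\<in>UNIV. of_int (struct_const d e c) * class_sum c)"
  unfolding struct_const_def by (rule theI'[OF struct_const_ex1])


section \<open>Integral polynomial rings and their tensor squares\<close>

type_synonym 'c zpoly = "('c \<Rightarrow>\<^sub>0 nat) \<Rightarrow>\<^sub>0 int"

definition zvar :: "'c \<Rightarrow> 'c zpoly" where
  "zvar c = Poly_Mapping.single (Poly_Mapping.single c 1) 1"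

definition zmonom :: "('c \<Rightarrow> 'r::comm_ring_1) \<Rightarrow> ('c \<Rightarrow>\<^sub>0 nat) \<Rightarrow> 'r" where
  "zmonom \<sigma> m = (\<Prod>c\<in>Poly_Mapping.keys m. \<sigma> c ^ Poly_Mapping.lookup m c)"

definition zpoly_eval :: "('c \<Rightarrow> 'r::comm_ring_1) \<Rightarrow> 'c zpoly \<Rightarrow> 'r" where
  "zpoly_eval \<sigma> p = (\<Sum>m\<in>Poly_Mapping.keys p. of_int (Poly_Mapping.lookup p m) * zmonom \<sigma> m)"

lemma zmonom_superset:
  assumes "finite S" "Poly_Mapping.keys m \<subseteq> S"
  shows "zmonom \<sigma> m = (\<Prod>c\<in>S. \<sigma> c ^ Poly_Mapping.lookup m c)"
  unfolding zmonom_def using assms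
  by (intro prod.mono_neutral_left) (auto simp: in_keys_iff)

lemma zmonom_0: "zmonom \<sigma> 0 = 1"
  by (simp add: zmonom_def)

lemma zmonom_add: "zmonom \<sigma> (m + n) = zmonom \<sigma> m * zmonom \<sigma> n"
proof -
  let ?S = "Poly_Mapping.keys m \<union> Poly_Mapping.keys n"
  have "zmonom \<sigma> (m + n) = (\<Prod>c\<in>?S. \<sigma> c ^ Poly_Mapping.lookup (m + n) c)"
    by (rule zmonom_superset) (simp_all add: keys_add)
  also have "\<dots> = zmonom \<sigma> m * zmonom \<sigma> n"
    by (simp add: lookup_add power_add prod.distrib zmonom_superset[of ?S])
  finally show ?thesis .
qed

lemma zpoly_eval_single: "zpoly_eval \<sigma> (Poly_Mapping.single m a) = of_int a * zmonom \<sigma> m"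
  by (simp add: zpoly_eval_def)

lemma zpoly_eval_add: "zpoly_eval \<sigma> (p + q) = zpoly_eval \<sigma> p + zpoly_eval \<sigma> q"
  unfolding zpoly_eval_def
  by (rule setsum_keys_plus_distrib) (simp_all add: algebra_simps)

lemma zpoly_eval_0: "zpoly_eval \<sigma> 0 = 0"
  by (simp add: zpoly_eval_def)

lemma zpoly_eval_sum: "zpoly_eval \<sigma> (sum f S) = (\<Sum>x\<in>S. zpoly_eval \<sigma> (f x))"
  by (induction S rule: infinite_finite_induct) (simp_all add: zpoly_eval_0 zpoly_eval_add)

lemma zpoly_eval_mult: "zpoly_eval \<sigma> (p * q) = zpoly_eval \<sigma> p * zpoly_eval \<sigma> q"
proof -
  have l: "additive (\<lambda>p. zpoly_eval \<sigma> (p * q))" "additive (\<lambda>p. zpoly_eval \<sigma> p * zpoly_eval \<sigma> q)"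
    and r: "additive (\<lambda>q. zpoly_eval \<sigma> (p * q))" "additive (\<lambda>q. zpoly_eval \<sigma> p * zpoly_eval \<sigma> q)" for p q
    by (simp_all add: additive_def zpoly_eval_add algebra_simps)
  show ?thesis
    by (rule additive_eqI[OF l], rule additive_eqI[OF r])
      (simp add: mult_single zpoly_eval_single zmonom_add mult_ac)
qed

lemma zpoly_eval_1: "zpoly_eval \<sigma> 1 = 1"
  by (simp add: zpoly_eval_def zmonom_0 lookup_one)

lemma zpoly_eval_zvar: "zpoly_eval \<sigma> (zvar c) = \<sigma> c"
  by (simp add: zvar_def zpoly_eval_single zmonom_def)

text \<open>
  The tensor product of the monoid rings \<open>\<int>[M]\<close> and \<open>\<int>[N]\<close> is modelled as the monoid ring
  \<open>\<int>[M \<times> N]\<close>, with \<open>m \<otimes> n\<close> corresponding to \<open>(m, n)\<close>. The lemma \<open>tensor_universal\<close> shows that it has the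
  universal property of the tensor product of abelian groups, and \<open>tensor_mult\<close> that its
  product is that of the tensor product of rings.
\<close>

definition tensor :: "('m \<Rightarrow>\<^sub>0 int) \<Rightarrow> ('n \<Rightarrow>\<^sub>0 int) \<Rightarrow> ('m \<times> 'n) \<Rightarrow>\<^sub>0 int" where
  "tensor p q = (\<Sum>m\<in>Poly_Mapping.keys p. \<Sum>n\<in>Poly_Mapping.keys q.
     Poly_Mapping.single (m, n) (Poly_Mapping.lookup p m * Poly_Mapping.lookup q n))"

definition tensor_lift ::
    "(('m \<Rightarrow>\<^sub>0 int) \<Rightarrow> ('n \<Rightarrow>\<^sub>0 int) \<Rightarrow> 'z::ab_group_add) \<Rightarrow> (('m \<times> 'n) \<Rightarrow>\<^sub>0 int) \<Rightarrow> 'z" where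
  "tensor_lift \<beta> x = (\<Sum>(m, n)\<in>Poly_Mapping.keys x.
     \<beta> (Poly_Mapping.single m (Poly_Mapping.lookup x (m, n))) (Poly_Mapping.single n 1))"

definition tensor_fun ::
    "(('m \<Rightarrow>\<^sub>0 int) \<Rightarrow> int) \<Rightarrow> (('n \<Rightarrow>\<^sub>0 int) \<Rightarrow> int) \<Rightarrow> (('m \<times> 'n) \<Rightarrow>\<^sub>0 int) \<Rightarrow> int" where
  "tensor_fun f g = tensor_lift (\<lambda>p q. f p * g q)"

lemma lookup_tensor:
  "Poly_Mapping.lookup (tensor p q) (m, n) = Poly_Mapping.lookup p m * Poly_Mapping.lookup q n"
proof -
  have "Poly_Mapping.lookup (tensor p q) (m, n) = (\<Sum>m'\<in>Poly_Mapping.keys p. \<Sum>n'\<in>Poly_Mapping.keys q.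
     if m' = m then (if n' = n then Poly_Mapping.lookup p m' * Poly_Mapping.lookup q n' else 0) else 0)"
    by (auto simp: tensor_def lookup_sum lookup_single when_def intro!: sum.cong)
  also have "\<dots> = (\<Sum>m'\<in>Poly_Mapping.keys p. if m' = m
      then (\<Sum>n'\<in>Poly_Mapping.keys q. if n' = n then Poly_Mapping.lookup p m' * Poly_Mapping.lookup q n' else 0) else 0)"
    by (intro sum.cong) auto
  also have "\<dots> = Poly_Mapping.lookup p m * Poly_Mapping.lookup q n"
    by (simp add: in_keys_iff)
  finally show ?thesis .
qed

lemma tensor_single:
  "tensor (Poly_Mapping.single m a) (Poly_Mapping.single n b) = Poly_Mapping.single (m, n) (a * b)"
  by (simp add: tensor_def)

lemma tensor_add_left: "tensor (p + p') q = tensor p q + tensor p' q"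
  by (rule poly_mapping_eqI) (auto simp: lookup_tensor lookup_add algebra_simps)

lemma tensor_add_right: "tensor p (q + q') = tensor p q + tensor p q'"
  by (rule poly_mapping_eqI) (auto simp: lookup_tensor lookup_add algebra_simps)

lemma tensor_mult:
  "tensor p q * tensor p' q' = tensor (p * p') (q * q')"
  for p p' :: "'m::monoid_add \<Rightarrow>\<^sub>0 int" and q q' :: "'n::monoid_add \<Rightarrow>\<^sub>0 int"
proof -
  have 1: "additive (\<lambda>p. tensor p q * tensor p' q')" "additive (\<lambda>p. tensor (p * p') (q * q'))"
    and 2: "additive (\<lambda>q. tensor p q * tensor p' q')" "additive (\<lambda>q. tensor (p * p') (q * q'))"
    and 3: "additive (\<lambda>p'. tensor p q * tensor p' q')" "additive (\<lambda>p'. tensor (p * p') (q * q'))"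
    and 4: "additive (\<lambda>q'. tensor p q * tensor p' q')" "additive (\<lambda>q'. tensor (p * p') (q * q'))"
    for p p' :: "'m \<Rightarrow>\<^sub>0 int" and q q' :: "'n \<Rightarrow>\<^sub>0 int"
    by (simp_all add: additive_def tensor_add_left tensor_add_right algebra_simps)
  show ?thesis
    by (rule additive_eqI[OF 1], rule additive_eqI[OF 2], rule additive_eqI[OF 3], rule additive_eqI[OF 4])
      (simp add: tensor_single mult_single mult_ac)
qed

lemma additive_int_eqI:
  fixes f g :: "int \<Rightarrow> 'z::ab_group_add"
  assumes "additive f" "additive g" "f 1 = g 1"
  shows "f a = g a"
proof -
  have nat: "f (int n) = g (int n)" for n
    by (induction n)
      (simp_all add: additive.zero[OF assms(1)] additive.zero[OF assms(2)]
        additive.add[OF assms(1)] additive.add[OF assms(2)] assms(3))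
  show ?thesis
    by (cases a rule: int_cases2)
      (simp_all add: nat additive.minus[OF assms(1)] additive.minus[OF assms(2)])
qed

lemma tensor_lift_additive:
  fixes \<beta> :: "('m \<Rightarrow>\<^sub>0 int) \<Rightarrow> ('n \<Rightarrow>\<^sub>0 int) \<Rightarrow> 'z::ab_group_add"
  assumes "\<And>q. additive (\<lambda>p. \<beta> p q)"
  shows "additive (tensor_lift \<beta>)"
  unfolding additive_def tensor_lift_def split_def prod.collapse
  by (intro allI setsum_keys_plus_distrib[where f = "\<lambda>k v. \<beta> (Poly_Mapping.single (fst k) v) (frag_of (snd k))"])
    (simp_all add: single_add additive.zero[OF assms] additive.add[OF assms])

lemma tensor_lift_tensor:
  fixes \<beta> :: "('m \<Rightarrow>\<^sub>0 int) \<Rightarrow> ('n \<Rightarrow>\<^sub>0 int) \<Rightarrow> 'z::ab_group_add"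
  assumes L: "\<And>q. additive (\<lambda>p. \<beta> p q)" and R: "\<And>p. additive (\<lambda>q. \<beta> p q)"
  shows "tensor_lift \<beta> (tensor p q) = \<beta> p q"
proof -
  note add = tensor_lift_additive[OF L, THEN additive.add]
  have 1: "additive (\<lambda>p. tensor_lift \<beta> (tensor p q))" for q
    by (simp add: additive_def tensor_add_left add)
  have 2: "additive (\<lambda>q. tensor_lift \<beta> (tensor p q))" for p
    by (simp add: additive_def tensor_add_right add)
  have single: "tensor_lift \<beta> (tensor (Poly_Mapping.single m a) (Poly_Mapping.single n b))
      = \<beta> (Poly_Mapping.single m a) (Poly_Mapping.single n b)" for m a n b
  proof -
    have "\<beta> (Poly_Mapping.single m (a * b)) (Poly_Mapping.single n 1)
        = \<beta> (Poly_Mapping.single m a) (Poly_Mapping.single n b)"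
    proof (rule additive_int_eqI[of _ _ b])
      show "additive (\<lambda>b. \<beta> (Poly_Mapping.single m (a * b)) (Poly_Mapping.single n 1))"
        by (simp add: additive_def distrib_left single_add additive.add[OF L])
      show "additive (\<lambda>b. \<beta> (Poly_Mapping.single m a) (Poly_Mapping.single n b))"
        by (simp add: additive_def single_add additive.add[OF R])
    qed simp
    then show ?thesis
      using additive.zero[OF L] by (auto simp: tensor_single tensor_lift_def)
  qed
  show ?thesis
    by (rule additive_eqI[OF 1 L], rule additive_eqI[OF 2 R], rule single)
qed

lemma tensor_universal:
  fixes \<beta> :: "('m \<Rightarrow>\<^sub>0 int) \<Rightarrow> ('n \<Rightarrow>\<^sub>0 int) \<Rightarrow> 'z::ab_group_add"
  assumes L: "\<And>q. additive (\<lambda>p. \<beta> p q)" and R: "\<And>p. additive (\<lambda>q. \<beta> p q)"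
  shows "\<exists>!h. additive h \<and> (\<forall>p q. h (tensor p q) = \<beta> p q)"
proof (rule ex1I[of _ "tensor_lift \<beta>"])
  show "additive (tensor_lift \<beta>) \<and> (\<forall>p q. tensor_lift \<beta> (tensor p q) = \<beta> p q)"
    by (simp add: tensor_lift_additive[OF L] tensor_lift_tensor[OF L R])
next
  fix h assume h: "additive h \<and> (\<forall>p q. h (tensor p q) = \<beta> p q)"
  have add: "additive (tensor_lift \<beta>)"
    by (rule tensor_lift_additive) (rule L)
  show "h = tensor_lift \<beta>"
  proof
    fix x
    have "h (Poly_Mapping.single k v) = tensor_lift \<beta> (Poly_Mapping.single k v)" for k v
    proof -
      have "Poly_Mapping.single k v = tensor (Poly_Mapping.single (fst k) v) (Poly_Mapping.single (snd k) 1)"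
        by (simp add: tensor_single)
      then show ?thesis
        using h by (simp only: tensor_lift_tensor[OF L R])
    qed
    then show "h x = tensor_lift \<beta> x"
      using h add by (intro additive_eqI[of h "tensor_lift \<beta>" x]) simp_all
  qed
qed

lemma tensor_fun_tensor:
  assumes "additive f" "additive g"
  shows "tensor_fun f g (tensor p q) = f p * g q"
  unfolding tensor_fun_def using assms
  by (intro tensor_lift_tensor) (simp_all add: additive_def algebra_simps)


section \<open>The distribution algebra\<close>

lemma ring_of_type_algebra_simps [simp]:
  "carrier ring_of_type_algebra = UNIV"
  "x \<otimes>\<^bsub>ring_of_type_algebra\<^esub> y = x * y"
  "\<one>\<^bsub>ring_of_type_algebra\<^esub> = 1"
  "\<zero>\<^bsub>ring_of_type_algebra\<^esub> = 0"
  "x \<oplus>\<^bsub>ring_of_type_algebra\<^esub> y = x + y"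
  by (simp_all add: ring_of_type_algebra_def)

lemma ring_ring_of_type_algebra: "ring (ring_of_type_algebra :: 'a::ring_1 ring)"
proof -
  have "\<exists>y. x + y = 0" for x :: 'a
    using add.right_inverse by blast
  then show ?thesis
    unfolding ring_of_type_algebra_def using add.right_inverse
    by unfold_locales (auto simp: algebra_simps Units_def)
qed

primrec ideal_power :: "('a, 'b) ring_scheme \<Rightarrow> 'a set \<Rightarrow> nat \<Rightarrow> 'a set" where
  "ideal_power R I 0 = carrier R"
| "ideal_power R I (Suc n) = ideal_prod R (ideal_power R I n) I"

type_synonym 'g class_poly = "'g conj_class zpoly"

definition aug_ideal :: "'g::{finite,group_add} class_poly set" where
  "aug_ideal = Idl\<^bsub>ring_of_type_algebra\<^esub> (insert (zvar class_id - 1) (zvar ` (UNIV - {class_id})))"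

definition comult ::
    "'g::{finite,group_add} class_poly \<Rightarrow> (('g conj_class \<Rightarrow>\<^sub>0 nat) \<times> ('g conj_class \<Rightarrow>\<^sub>0 nat)) \<Rightarrow>\<^sub>0 int" where
  "comult = zpoly_eval (\<lambda>c. \<Sum>d\<in>UNIV. \<Sum>e\<in>UNIV. of_int (struct_const d e c) * tensor (zvar d) (zvar e))"

text \<open>
  The canonical map onto the quotient by \<open>aug_ideal\<close>, identified with \<open>\<int>\<close>; see \<open>counit_eq_iff\<close>.
\<close>

definition counit :: "'g::{finite,group_add} class_poly \<Rightarrow> int" where
  "counit = zpoly_eval (\<lambda>c. if c = class_id then 1 else 0)"

lemma aug_ideal: "ideal aug_ideal ring_of_type_algebra"
  unfolding aug_ideal_def
  by (rule ring.genideal_ideal[OF ring_ring_of_type_algebra]) simp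

lemma aug_ideal_closed:
  shows "0 \<in> aug_ideal"
    and "p \<in> aug_ideal \<Longrightarrow> q \<in> aug_ideal \<Longrightarrow> p + q \<in> aug_ideal"
    and "p \<in> aug_ideal \<Longrightarrow> q * p \<in> aug_ideal"
  using additive_subgroup.zero_closed[OF ideal.axioms(1)[OF aug_ideal]]
    additive_subgroup.a_closed[OF ideal.axioms(1)[OF aug_ideal]]
    ideal.I_l_closed[OF aug_ideal]
  by auto

lemma aug_ideal_gens: "zvar c - of_int (counit (zvar c)) \<in> aug_ideal"
proof -
  have "insert (zvar class_id - 1) (zvar ` (UNIV - {class_id})) \<subseteq> (aug_ideal :: 'a class_poly set)"
    unfolding aug_ideal_def
    by (rule ring.genideal_self[OF ring_ring_of_type_algebra]) simp
  then show ?thesis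
    by (auto simp: counit_def zpoly_eval_zvar)
qed

lemma zmonom_zvar: "zmonom zvar m = Poly_Mapping.single m 1"
proof -
  have pow: "zvar c ^ k = Poly_Mapping.single (Poly_Mapping.single c k) 1" for c :: 'a and k
    by (induction k) (simp_all add: zvar_def mult_single single_add[symmetric] add.commute)
  have prod: "(\<Prod>c\<in>S. Poly_Mapping.single (f c) 1) = (Poly_Mapping.single (sum f S) 1 :: 'a zpoly)"
    for f :: "'a \<Rightarrow> 'a \<Rightarrow>\<^sub>0 nat" and S
    by (induction S rule: infinite_finite_induct) (simp_all add: mult_single)
  show ?thesis
    by (simp only: zmonom_def pow prod poly_mapping_sum_single[symmetric])
qed

lemma aug_ideal_diff_counit: "p - of_int (counit p) \<in> aug_ideal"
proof -
  let ?P = "\<lambda>p::'a class_poly. p - of_int (counit p) \<in> aug_ideal"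
  have add: "?P (p + q)" if "?P p" "?P q" for p q
  proof -
    have "p + q - of_int (counit (p + q)) = (p - of_int (counit p)) + (q - of_int (counit q))"
      by (simp add: counit_def zpoly_eval_add)
    then show ?thesis using that by (simp only: aug_ideal_closed)
  qed
  have mult: "?P (p * q)" if "?P p" "?P q" for p q
  proof -
    have "p * q - of_int (counit (p * q))
        = q * (p - of_int (counit p)) + of_int (counit p) * (q - of_int (counit q))"
      by (simp add: counit_def zpoly_eval_mult algebra_simps)
    then show ?thesis using that by (simp only: aug_ideal_closed)
  qed
  have const: "?P (Poly_Mapping.single 0 a)" for a
  proof -
    have "Poly_Mapping.single 0 a = (of_int a :: 'a class_poly)"
      using single_of_int[of a, where ?'b = int] by (metis of_int_eq_id id_apply)
    moreover have "counit (Poly_Mapping.single 0 a :: 'a class_poly) = a"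
      by (simp add: counit_def zpoly_eval_single zmonom_0)
    ultimately show ?thesis by (simp add: aug_ideal_closed)
  qed
  have one: "?P 1" using const[of 1] by simp
  have pow: "?P (zvar c ^ k)" for c k
    by (induction k) (use one mult aug_ideal_gens in auto)
  have prod: "?P (\<Prod>c\<in>S. zvar c ^ f c)" for f S
    by (induction S rule: infinite_finite_induct) (use one mult pow in auto)
  have single: "?P (Poly_Mapping.single m a)" for m a
  proof -
    have "?P (Poly_Mapping.single 0 a * zmonom zvar m)"
      unfolding zmonom_def by (rule mult[OF const prod])
    then show ?thesis by (simp add: zmonom_zvar mult_single)
  qed
  have "?P (\<Sum>k\<in>S. Poly_Mapping.single k (f k))" for S f
    by (induction S rule: infinite_finite_induct)
      (use const[of 0] single add in auto)
  then show ?thesis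
    by (metis poly_mapping_sum_single)
qed

lemma counit_aug_ideal: "p \<in> aug_ideal \<Longrightarrow> counit p = 0"
proof -
  have "ideal {p. counit p = 0} (ring_of_type_algebra :: 'a class_poly ring)"
  proof (rule idealI[OF ring_ring_of_type_algebra])
    interpret ring "ring_of_type_algebra :: 'a class_poly ring"
      by (rule ring_ring_of_type_algebra)
    show "subgroup {p. counit p = 0} (add_monoid (ring_of_type_algebra :: 'a class_poly ring))"
    proof (rule group.subgroupI)
      show "group (add_monoid (ring_of_type_algebra :: 'a class_poly ring))"
        by (rule add.is_group)
    next
      fix a :: "'a class_poly" assume a: "a \<in> {p. counit p = 0}"
      have "(\<ominus>\<^bsub>ring_of_type_algebra\<^esub> a) = - a"
        by (rule minus_equality) simp_all
      moreover have "counit (- a) = 0"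
      proof -
        have "counit (- a + a) = counit (- a) + counit a"
          unfolding counit_def by (rule zpoly_eval_add)
        then show ?thesis using a by (simp add: counit_def zpoly_eval_0)
      qed
      ultimately show "inv\<^bsub>add_monoid ring_of_type_algebra\<^esub> a \<in> {p. counit p = 0}"
        by (simp add: a_inv_def)
    qed (auto simp: counit_def zpoly_eval_add intro: exI[of _ 0] zpoly_eval_0)
  qed (auto simp: counit_def zpoly_eval_mult)
  moreover have "insert (zvar class_id - 1) (zvar ` (UNIV - {class_id})) \<subseteq> {p :: 'a class_poly. counit p = 0}"
  proof -
    have "counit (zvar class_id - 1 + 1 :: 'a class_poly)
        = counit (zvar class_id - 1 :: 'a class_poly) + counit (1 :: 'a class_poly)"
      unfolding counit_def by (rule zpoly_eval_add)
    then show ?thesis by (auto simp: counit_def zpoly_eval_zvar zpoly_eval_1)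
  qed
  ultimately have "(aug_ideal :: 'a class_poly set) \<subseteq> {p. counit p = 0}"
    unfolding aug_ideal_def by (rule ring.genideal_minimal[OF ring_ring_of_type_algebra])
  then show "p \<in> aug_ideal \<Longrightarrow> counit p = 0" for p :: "'a class_poly" by auto
qed

lemma counit_eq_iff: "counit p = k \<longleftrightarrow> p - of_int k \<in> aug_ideal"
proof
  assume "counit p = k"
  then show "p - of_int k \<in> aug_ideal"
    using aug_ideal_diff_counit[of p] by simp
next
  assume "p - of_int k \<in> aug_ideal"
  then have 0: "counit (p - of_int k) = 0" by (rule counit_aug_ideal)
  have "counit (of_int k :: 'a class_poly) = k"
  proof -
    have "(of_int k :: 'a class_poly) = Poly_Mapping.single 0 k"
      using single_of_int[of k, where ?'b = int] by (metis of_int_eq_id id_apply)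
    then show ?thesis by (simp only: counit_def zpoly_eval_single zmonom_0) simp
  qed
  moreover have "counit (p - of_int k + of_int k) = counit (p - of_int k) + counit (of_int k :: 'a class_poly)"
    unfolding counit_def by (rule zpoly_eval_add)
  ultimately show "counit p = k" using 0 by simp
qed

definition distribution_algebra :: "('g::{finite,group_add} class_poly \<Rightarrow> int) ring" where
  "distribution_algebra = \<lparr>
     carrier = {f. additive f \<and> (\<exists>n. \<forall>a\<in>ideal_power ring_of_type_algebra aug_ideal n. f a = 0)},
     monoid.mult = (\<lambda>f g a. tensor_fun f g (comult a)),
     one = counit,
     ring.zero = (\<lambda>_. 0),
     add = (\<lambda>f g a. f a + g a)\<rparr>"


section \<open>Rational Lie algebras and enveloping algebras\<close>

class rat_vector = ab_group_add +
  fixes scaleQ :: "rat \<Rightarrow> 'a \<Rightarrow> 'a" (infixr \<open>*\<^sub>Q\<close> 75)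
  assumes scaleQ_add_right: "a *\<^sub>Q (x + y) = a *\<^sub>Q x + a *\<^sub>Q y"
    and scaleQ_add_left: "(a + b) *\<^sub>Q x = a *\<^sub>Q x + b *\<^sub>Q x"
    and scaleQ_scaleQ: "a *\<^sub>Q (b *\<^sub>Q x) = (a * b) *\<^sub>Q x"
    and scaleQ_one: "1 *\<^sub>Q x = x"

class rat_algebra_1 = rat_vector + ring_1 +
  assumes mult_scaleQ_left: "(a *\<^sub>Q x) * y = a *\<^sub>Q (x * y)"
    and mult_scaleQ_right: "x * (a *\<^sub>Q y) = a *\<^sub>Q (x * y)"

class rat_lie_algebra = rat_vector +
  fixes lie_bracket :: "'a \<Rightarrow> 'a \<Rightarrow> 'a"
  assumes lie_add_left: "lie_bracket (x + y) z = lie_bracket x z + lie_bracket y z"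
    and lie_add_right: "lie_bracket x (y + z) = lie_bracket x y + lie_bracket x z"
    and lie_scaleQ_left: "lie_bracket (a *\<^sub>Q x) y = a *\<^sub>Q lie_bracket x y"
    and lie_scaleQ_right: "lie_bracket x (a *\<^sub>Q y) = a *\<^sub>Q lie_bracket x y"
    and lie_self: "lie_bracket x x = 0"
    and lie_jacobi: "lie_bracket x (lie_bracket y z) + lie_bracket y (lie_bracket z x)
      + lie_bracket z (lie_bracket x y) = 0"

datatype 'a free_word = Word (letters: "'a list")

instantiation free_word :: (type) monoid_add
begin

definition zero_free_word :: "'a free_word" where
  "0 = Word []"

definition plus_free_word :: "'a free_word \<Rightarrow> 'a free_word \<Rightarrow> 'a free_word" where
  "u + v = Word (letters u @ letters v)"

instance
  by standard (simp_all add: zero_free_word_def plus_free_word_def)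

end

text \<open>
  \<open>'a free_word \<Rightarrow>\<^sub>0 rat\<close> is the free associative \<open>\<rat>\<close>-algebra on the elements of \<open>'a\<close>. The first two
  families of relators below turn it into the tensor algebra of the vector space \<open>'a\<close>, the
  third one then gives the enveloping algebra.
\<close>

definition free_gen :: "'a \<Rightarrow> 'a free_word \<Rightarrow>\<^sub>0 rat" where
  "free_gen x = Poly_Mapping.single (Word [x]) 1"

definition env_relators :: "('l::rat_lie_algebra free_word \<Rightarrow>\<^sub>0 rat) set" where
  "env_relators =
     {free_gen (x + y) - free_gen x - free_gen y | x y. True}
   \<union> {free_gen (a *\<^sub>Q x) - Poly_Mapping.single 0 a * free_gen x | a x. True}
   \<union> {free_gen x * free_gen y - free_gen y * free_gen x - free_gen (lie_bracket x y) | x y. True}"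

definition env_ideal :: "('l::rat_lie_algebra free_word \<Rightarrow>\<^sub>0 rat) set" where
  "env_ideal = Idl\<^bsub>ring_of_type_algebra\<^esub> env_relators"

lemma env_ideal: "ideal env_ideal ring_of_type_algebra"
  unfolding env_ideal_def
  by (rule ring.genideal_ideal[OF ring_ring_of_type_algebra]) simp

lemma env_ideal_closed:
  shows "0 \<in> env_ideal"
    and "p \<in> env_ideal \<Longrightarrow> q \<in> env_ideal \<Longrightarrow> p + q \<in> env_ideal"
    and "p \<in> env_ideal \<Longrightarrow> q * p \<in> env_ideal"
    and "p \<in> env_ideal \<Longrightarrow> p * q \<in> env_ideal"
  using additive_subgroup.zero_closed[OF ideal.axioms(1)[OF env_ideal]]
    additive_subgroup.a_closed[OF ideal.axioms(1)[OF env_ideal]]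
    ideal.I_l_closed[OF env_ideal] ideal.I_r_closed[OF env_ideal]
  by auto

lemma env_ideal_uminus: "p \<in> env_ideal \<Longrightarrow> - p \<in> env_ideal"
  using env_ideal_closed(3)[of p "- 1"] by simp

quotient_type (overloaded) 'l enveloping = "'l::rat_lie_algebra free_word \<Rightarrow>\<^sub>0 rat" /
  "\<lambda>p q. p - q \<in> env_ideal"
proof (rule equivpI)
  show "reflp (\<lambda>p q. p - q \<in> (env_ideal :: ('l free_word \<Rightarrow>\<^sub>0 rat) set))"
    by (simp add: reflp_def env_ideal_closed)
  show "symp (\<lambda>p q. p - q \<in> (env_ideal :: ('l free_word \<Rightarrow>\<^sub>0 rat) set))"
    by (rule sympI) (use env_ideal_uminus in fastforce)
  show "transp (\<lambda>p q. p - q \<in> (env_ideal :: ('l free_word \<Rightarrow>\<^sub>0 rat) set))"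
    by (rule transpI) (use env_ideal_closed(2) in fastforce)
qed

lemma lookup_mult_0:
  "Poly_Mapping.lookup (p * q) 0 = Poly_Mapping.lookup p 0 * Poly_Mapping.lookup q 0"
  for p q :: "'a free_word \<Rightarrow>\<^sub>0 rat"
proof -
  have 1: "additive (\<lambda>p. Poly_Mapping.lookup (p * q) 0)"
      "additive (\<lambda>p. Poly_Mapping.lookup p 0 * Poly_Mapping.lookup q 0)"
    and 2: "additive (\<lambda>q. Poly_Mapping.lookup (p * q) 0)"
      "additive (\<lambda>q. Poly_Mapping.lookup p 0 * Poly_Mapping.lookup q 0)"
    for p q :: "'a free_word \<Rightarrow>\<^sub>0 rat"
    by (simp_all add: additive_def lookup_add algebra_simps)
  have zero: "u + v = 0 \<longleftrightarrow> u = 0 \<and> v = 0" for u v :: "'a free_word"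
    by (cases u; cases v) (simp add: zero_free_word_def plus_free_word_def)
  show ?thesis
    by (rule additive_eqI[OF 1], rule additive_eqI[OF 2])
      (auto simp: mult_single lookup_single when_def zero)
qed

lemma lookup_env_ideal: "p \<in> env_ideal \<Longrightarrow> Poly_Mapping.lookup p 0 = 0"
  for p :: "'l::rat_lie_algebra free_word \<Rightarrow>\<^sub>0 rat"
proof -
  let ?R = "ring_of_type_algebra :: ('l free_word \<Rightarrow>\<^sub>0 rat) ring"
  interpret ring ?R by (rule ring_ring_of_type_algebra)
  have "ideal {p. Poly_Mapping.lookup p 0 = 0} ?R"
  proof (rule idealI[OF ring_ring_of_type_algebra])
    show "subgroup {p. Poly_Mapping.lookup p 0 = 0} (add_monoid ?R)"
    proof (rule group.subgroupI)
      show "group (add_monoid ?R)" by (rule add.is_group)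
    next
      fix a :: "'l free_word \<Rightarrow>\<^sub>0 rat" assume a: "a \<in> {p. Poly_Mapping.lookup p 0 = 0}"
      have "(\<ominus>\<^bsub>?R\<^esub> a) = - a"
        by (rule minus_equality) simp_all
      then show "inv\<^bsub>add_monoid ?R\<^esub> a \<in> {p. Poly_Mapping.lookup p 0 = 0}"
        using a by (simp add: a_inv_def)
    qed (auto simp: lookup_add intro: exI[of _ 0])
  qed (auto simp: lookup_mult_0)
  moreover have "(env_relators :: ('l free_word \<Rightarrow>\<^sub>0 rat) set) \<subseteq> {p. Poly_Mapping.lookup p 0 = 0}"
  proof -
    have "Word [x] \<noteq> 0" "0 \<noteq> Word [x]" for x :: 'l
      by (simp_all add: zero_free_word_def)
    then show ?thesis
      by (auto simp: env_relators_def free_gen_def lookup_minus lookup_mult_0 lookup_single when_def)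
  qed
  ultimately have "(env_ideal :: ('l free_word \<Rightarrow>\<^sub>0 rat) set) \<subseteq> {p. Poly_Mapping.lookup p 0 = 0}"
    unfolding env_ideal_def by (rule genideal_minimal)
  then show "p \<in> env_ideal \<Longrightarrow> Poly_Mapping.lookup p 0 = 0" for p :: "'l free_word \<Rightarrow>\<^sub>0 rat"
    by auto
qed

lemma single_0_central: "p * Poly_Mapping.single 0 a = Poly_Mapping.single 0 a * p"
  for p :: "'k::monoid_add \<Rightarrow>\<^sub>0 'r::comm_ring_1"
proof -
  have "additive (\<lambda>p. p * Poly_Mapping.single 0 a)" "additive (\<lambda>p. Poly_Mapping.single 0 a * p)"
    by (simp_all add: additive_def algebra_simps)
  then show ?thesis
    by (rule additive_eqI) (simp add: mult_single mult.commute)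
qed

instantiation enveloping :: (rat_lie_algebra) rat_algebra_1
begin

lift_definition zero_enveloping :: "'a enveloping" is 0 .

lift_definition one_enveloping :: "'a enveloping" is 1 .

lift_definition plus_enveloping :: "'a enveloping \<Rightarrow> 'a enveloping \<Rightarrow> 'a enveloping" is "(+)"
proof -
  fix p p' q q' :: "'a free_word \<Rightarrow>\<^sub>0 rat"
  assume "p - p' \<in> env_ideal" "q - q' \<in> env_ideal"
  then have "(p - p') + (q - q') \<in> env_ideal" by (rule env_ideal_closed)
  then show "p + q - (p' + q') \<in> env_ideal" by (simp add: algebra_simps)
qed

lift_definition uminus_enveloping :: "'a enveloping \<Rightarrow> 'a enveloping" is uminus
  by (drule env_ideal_uminus) simp

lift_definition minus_enveloping :: "'a enveloping \<Rightarrow> 'a enveloping \<Rightarrow> 'a enveloping" is "(-)"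
proof -
  fix p p' q q' :: "'a free_word \<Rightarrow>\<^sub>0 rat"
  assume "p - p' \<in> env_ideal" "q - q' \<in> env_ideal"
  then have "(p - p') + - (q - q') \<in> env_ideal" by (intro env_ideal_closed env_ideal_uminus)
  then show "p - q - (p' - q') \<in> env_ideal" by (simp add: algebra_simps)
qed

lift_definition times_enveloping :: "'a enveloping \<Rightarrow> 'a enveloping \<Rightarrow> 'a enveloping" is "(*)"
proof -
  fix p p' q q' :: "'a free_word \<Rightarrow>\<^sub>0 rat"
  assume "p - p' \<in> env_ideal" "q - q' \<in> env_ideal"
  then have "(p - p') * q + p' * (q - q') \<in> env_ideal" by (intro env_ideal_closed)
  then show "p * q - p' * q' \<in> env_ideal" by (simp add: algebra_simps)
qed

lift_definition scaleQ_enveloping :: "rat \<Rightarrow> 'a enveloping \<Rightarrow> 'a enveloping"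
  is "\<lambda>a p. Poly_Mapping.single 0 a * p"
  by (simp add: right_diff_distrib[symmetric] env_ideal_closed)

instance
proof
  fix x y z :: "'a enveloping" and a b :: rat
  note eqI = env_ideal_closed(1)
  show "x + y + z = x + (y + z)" by transfer (simp add: eqI algebra_simps)
  show "x + y = y + x" by transfer (simp add: eqI algebra_simps)
  show "0 + x = x" by transfer (simp add: eqI)
  show "- x + x = 0" by transfer (simp add: eqI)
  show "x - y = x + - y" by transfer (simp add: eqI)
  show "x * y * z = x * (y * z)" by transfer (simp add: eqI algebra_simps)
  show "(x + y) * z = x * z + y * z" by transfer (simp add: eqI algebra_simps)
  show "x * (y + z) = x * y + x * z" by transfer (simp add: eqI algebra_simps)
  show "1 * x = x" by transfer (simp add: eqI)
  show "x * 1 = x" by transfer (simp add: eqI)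
  show "(0 :: 'a enveloping) \<noteq> 1" by transfer (auto dest: lookup_env_ideal simp: lookup_minus)
  show "a *\<^sub>Q (x + y) = a *\<^sub>Q x + a *\<^sub>Q y" by transfer (simp add: eqI algebra_simps)
  show "(a + b) *\<^sub>Q x = a *\<^sub>Q x + b *\<^sub>Q x" by transfer (simp add: eqI single_add algebra_simps)
  show "a *\<^sub>Q (b *\<^sub>Q x) = (a * b) *\<^sub>Q x"
    by transfer (simp add: eqI mult_single mult.assoc[symmetric])
  show "1 *\<^sub>Q x = x" by transfer (simp add: eqI)
  show "(a *\<^sub>Q x) * y = a *\<^sub>Q (x * y)" by transfer (simp add: eqI mult.assoc)
  show "x * (a *\<^sub>Q y) = a *\<^sub>Q (x * y)"
    by transfer (simp add: eqI mult.assoc[symmetric] single_0_central)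
qed

end

lift_definition env_incl :: "'l::rat_lie_algebra \<Rightarrow> 'l enveloping" is free_gen .


section \<open>The centre of the rational group algebra as an abelian Lie algebra\<close>

typedef (overloaded) 'g rat_centre = "{x :: 'g::group_add \<Rightarrow>\<^sub>0 rat. \<forall>y. x * y = y * x}"
  by (rule exI[of _ 0]) simp

setup_lifting type_definition_rat_centre

instantiation rat_centre :: (group_add) "{comm_ring_1, rat_algebra_1, rat_lie_algebra}"
begin

lift_definition zero_rat_centre :: "'a rat_centre" is 0 by simp

lift_definition one_rat_centre :: "'a rat_centre" is 1 by simp

lift_definition plus_rat_centre :: "'a rat_centre \<Rightarrow> 'a rat_centre \<Rightarrow> 'a rat_centre" is "(+)"
  by (simp add: algebra_simps)

lift_definition uminus_rat_centre :: "'a rat_centre \<Rightarrow> 'a rat_centre" is uminus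
  by simp

lift_definition minus_rat_centre :: "'a rat_centre \<Rightarrow> 'a rat_centre \<Rightarrow> 'a rat_centre" is "(-)"
  by (simp add: algebra_simps)

lift_definition times_rat_centre :: "'a rat_centre \<Rightarrow> 'a rat_centre \<Rightarrow> 'a rat_centre" is "(*)"
  by (metis mult.assoc)

lift_definition scaleQ_rat_centre :: "rat \<Rightarrow> 'a rat_centre \<Rightarrow> 'a rat_centre"
  is "\<lambda>a x. Poly_Mapping.single 0 a * x"
  by (metis mult.assoc single_0_central)

definition lie_bracket_rat_centre :: "'a rat_centre \<Rightarrow> 'a rat_centre \<Rightarrow> 'a rat_centre" where
  "lie_bracket_rat_centre x y = 0"

instance
proof
  fix x y z :: "'a rat_centre" and a b :: rat
  note rep = Rep_rat_centre_inject[symmetric] zero_rat_centre.rep_eq one_rat_centre.rep_eq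
    plus_rat_centre.rep_eq uminus_rat_centre.rep_eq minus_rat_centre.rep_eq
    times_rat_centre.rep_eq scaleQ_rat_centre.rep_eq
  have central: "Rep_rat_centre x * p = p * Rep_rat_centre x" for x :: "'a rat_centre" and p
    using Rep_rat_centre[of x] by blast
  show "x + y + z = x + (y + z)" by (simp add: rep algebra_simps)
  show "x + y = y + x" by (simp add: rep algebra_simps)
  show "0 + x = x" by (simp add: rep algebra_simps)
  show "- x + x = 0" by (simp add: rep algebra_simps)
  show "x - y = x + - y" by (simp add: rep algebra_simps)
  show "x * y * z = x * (y * z)" by (simp add: rep algebra_simps)
  show "x * y = y * x" unfolding rep by (rule central)
  show "(x + y) * z = x * z + y * z" by (simp add: rep algebra_simps)
  show "1 * x = x" by (simp add: rep algebra_simps)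
  show "x * 1 = x" by (simp add: rep algebra_simps)
  show "x * (y + z) = x * y + x * z" by (simp add: rep algebra_simps)
  show "(0 :: 'a rat_centre) \<noteq> 1" by (simp add: rep algebra_simps)
  show "a *\<^sub>Q (x + y) = a *\<^sub>Q x + a *\<^sub>Q y" by (simp add: rep algebra_simps)
  show "(a + b) *\<^sub>Q x = a *\<^sub>Q x + b *\<^sub>Q x" by (simp add: rep single_add algebra_simps)
  show "a *\<^sub>Q (b *\<^sub>Q x) = (a * b) *\<^sub>Q x"
    by (simp add: rep mult_single mult.assoc[symmetric])
  show "1 *\<^sub>Q x = x" by (simp add: rep algebra_simps)
  show "(a *\<^sub>Q x) * y = a *\<^sub>Q (x * y)" by (simp add: rep algebra_simps)
  show "x * (a *\<^sub>Q y) = a *\<^sub>Q (x * y)"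
    by (simp add: rep mult.assoc[symmetric] single_0_central)
  have scaleQ_0: "a *\<^sub>Q (0 :: 'a rat_centre) = 0" by (simp add: rep)
  have add_0: "(0 :: 'a rat_centre) + 0 = 0" by (simp add: rep)
  show "lie_bracket (x + y) z = lie_bracket x z + lie_bracket y z"
    "lie_bracket x (y + z) = lie_bracket x y + lie_bracket x z"
    "lie_bracket (a *\<^sub>Q x) y = a *\<^sub>Q lie_bracket x y"
    "lie_bracket x (a *\<^sub>Q y) = a *\<^sub>Q lie_bracket x y"
    "lie_bracket x x = 0"
    "lie_bracket x (lie_bracket y z) + lie_bracket y (lie_bracket z x)
      + lie_bracket z (lie_bracket x y) = 0"
    by (simp_all add: lie_bracket_rat_centre_def scaleQ_0 add_0)
qed

end

lift_definition centre_class :: "'g::{finite,group_add} conj_class \<Rightarrow> 'g rat_centre" is class_sum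
  using class_sum_central by blast


section \<open>Formal power series\<close>

text \<open>
  A formal power series in variables indexed by \<open>'c\<close> is the function giving the coefficient of
  each monomial \<open>'c \<Rightarrow>\<^sub>0 nat\<close>; the sum in \<open>mps_mult\<close> is finite by \<open>finite_antidiagonal\<close>. In \<open>mps_exp f\<close>
  and \<open>mps_log1p f\<close> (the series \<open>exp f\<close> and \<open>log (1 + f)\<close>) the series \<open>f\<close> is meant to have constant
  coefficient \<open>0\<close>; then every coefficient of the infinite sum has only finitely many nonzero
  terms, which is what \<^const>\<open>Sum_any\<close> requires.
\<close>

type_synonym ('c, 'r) mps = "('c \<Rightarrow>\<^sub>0 nat) \<Rightarrow> 'r"

definition mps_mult :: "('c, 'r::semiring_1) mps \<Rightarrow> ('c, 'r) mps \<Rightarrow> ('c, 'r) mps" where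
  "mps_mult f g N = (\<Sum>(K, L) | K + L = N. f K * g L)"

primrec mps_power :: "('c, 'r::semiring_1) mps \<Rightarrow> nat \<Rightarrow> ('c, 'r) mps" where
  "mps_power f 0 = (\<lambda>N. if N = 0 then 1 else 0)"
| "mps_power f (Suc k) = mps_mult f (mps_power f k)"

definition mps_exp :: "('c, 'r::rat_algebra_1) mps \<Rightarrow> ('c, 'r) mps" where
  "mps_exp f N = Sum_any (\<lambda>k. (1 / fact k) *\<^sub>Q mps_power f k N)"

definition mps_log1p :: "('c, 'r::rat_algebra_1) mps \<Rightarrow> ('c, 'r) mps" where
  "mps_log1p f N = Sum_any (\<lambda>k. ((-1) ^ k / of_nat (Suc k)) *\<^sub>Q mps_power f (Suc k) N)"

lemma finite_antidiagonal: "finite {(K, L). K + L = N}" for N :: "'c \<Rightarrow>\<^sub>0 nat"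
proof -
  let ?A = "Poly_Mapping.keys N" and ?B = "{..Max (insert 0 (Poly_Mapping.lookup N ` Poly_Mapping.keys N))}"
  let ?F = "{f. \<forall>x. (x \<in> ?A \<longrightarrow> f x \<in> ?B) \<and> (x \<notin> ?A \<longrightarrow> f x = (0::nat))}"
  have le: "Poly_Mapping.lookup K \<in> ?F" if "\<And>c. Poly_Mapping.lookup K c \<le> Poly_Mapping.lookup N c" for K
  proof -
    have "Poly_Mapping.lookup K c \<in> ?B" if "c \<in> ?A" for c
      using \<open>\<And>c. Poly_Mapping.lookup K c \<le> Poly_Mapping.lookup N c\<close>[of c] that
      by (auto intro!: order_trans[OF _ Max_ge])
    moreover have "Poly_Mapping.lookup K c = 0" if "c \<notin> ?A" for c
      using \<open>\<And>c. Poly_Mapping.lookup K c \<le> Poly_Mapping.lookup N c\<close>[of c] that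
      by (simp add: in_keys_iff)
    ultimately show ?thesis by blast
  qed
  have "finite ?F" by (rule finite_set_of_finite_funs) simp_all
  then have "finite (Poly_Mapping.lookup -` ?F)"
    by (rule finite_vimageI) (rule injI, simp)
  then have "finite ((Poly_Mapping.lookup -` ?F) \<times> (Poly_Mapping.lookup -` ?F))" by blast
  moreover have "{(K, L). K + L = N} \<subseteq> (Poly_Mapping.lookup -` ?F) \<times> (Poly_Mapping.lookup -` ?F)"
  proof
    fix KL assume "KL \<in> {(K, L). K + L = N}"
    then obtain K L where KL: "KL = (K, L)" and N: "N = K + L" by auto
    have "Poly_Mapping.lookup K c \<le> Poly_Mapping.lookup N c"
      "Poly_Mapping.lookup L c \<le> Poly_Mapping.lookup N c" for c
      by (simp_all add: N lookup_add)
    then have "Poly_Mapping.lookup K \<in> ?F" "Poly_Mapping.lookup L \<in> ?F"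
      by (simp_all only: le)
    then show "KL \<in> (Poly_Mapping.lookup -` ?F) \<times> (Poly_Mapping.lookup -` ?F)"
      unfolding KL by (intro SigmaI vimageI2)
  qed
  ultimately show ?thesis by (rule finite_subset[rotated])
qed

lemma mps_power_eq_0:
  fixes f :: "('c, 'r::semiring_1) mps"
  assumes "f 0 = 0" and "(\<Sum>c\<in>Poly_Mapping.keys N. Poly_Mapping.lookup N c) < k"
  shows "mps_power f k N = 0"
  using assms(2)
proof (induction k arbitrary: N)
  case (Suc k)
  let ?deg = "\<lambda>N. \<Sum>c\<in>Poly_Mapping.keys N. Poly_Mapping.lookup N c"
  have deg: "?deg M = (\<Sum>c\<in>S. Poly_Mapping.lookup M c)" if "finite S" "Poly_Mapping.keys M \<subseteq> S" for M :: "'c \<Rightarrow>\<^sub>0 nat" and S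
    using that by (intro sum.mono_neutral_left) (auto simp: in_keys_iff)
  have "f K * mps_power f k L = 0" if KL: "K + L = N" for K L
  proof (cases "K = 0")
    case False
    let ?S = "Poly_Mapping.keys K \<union> Poly_Mapping.keys L"
    have "?deg N = (\<Sum>c\<in>?S. Poly_Mapping.lookup N c)" "?deg K = (\<Sum>c\<in>?S. Poly_Mapping.lookup K c)"
      "?deg L = (\<Sum>c\<in>?S. Poly_Mapping.lookup L c)"
      using keys_add[of K L] KL by (intro deg; simp)+
    then have "?deg K + ?deg L = ?deg N"
      unfolding KL[symmetric] by (simp only: lookup_add sum.distrib)
    moreover have "?deg K \<noteq> 0"
      using False by (auto simp: in_keys_iff poly_mapping_eq_iff fun_eq_iff)
    ultimately have "mps_power f k L = 0"
      using Suc.prems by (intro Suc.IH) linarith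
    then show ?thesis by simp
  qed (simp add: assms(1))
  then show ?case
    by (auto simp: mps_mult_def intro!: sum.neutral)
qed simp

section \<open>Weighted integer-valued polynomials\<close>

text \<open>
  \<open>class_series\<close> is \<open>\<Sum>c. c x\<^sub>c\<close>, with coefficients in the centre of the rational group algebra, and
  \<open>weighted_basis N\<close> is the coefficient of the monomial \<open>N\<close> in \<open>exp (T (log (1 + \<Sum>c. c x\<^sub>c)))\<close>, where
  \<open>T\<close> applies the canonical map into the enveloping algebra to each coefficient. The logarithm
  uses the associative product of the centre.
\<close>

definition class_series :: "('g::{finite,group_add} conj_class, 'g rat_centre) mps" where
  "class_series N = (\<Sum>c\<in>UNIV. if N = Poly_Mapping.single c 1 then centre_class c else 0)"

definition weighted_basis :: "('g::{finite,group_add} conj_class, 'g rat_centre enveloping) mps" where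
  "weighted_basis = mps_exp (\<lambda>N. env_incl (mps_log1p class_series N))"

definition weighted_ivp_ring :: "('g::{finite,group_add} rat_centre enveloping) ring" where
  "weighted_ivp_ring = ring_of_type_algebra\<lparr>carrier :=
     {\<Sum>N\<in>S. of_int (k N) * weighted_basis N | S k. finite S}\<rparr>"

end

theory Submission
  imports Defs "HOL-Library.Function_Algebras"
begin

text \<open>
  Let \<open>X = \<Sum>c. c x\<^sub>c\<close> be the generic central element and \<open>B(x) = exp (T (log (1 + X)))\<close> the generating
  series of \<open>B\<^sub>N = weighted_basis N\<close>. Let \<open>e\<^sub>N = coord_fun N\<close> be the functional that reads off the
  coefficient of the \<open>N\<close>-th monomial in the \<open>t\<^sub>c - \<delta>\<^sub>c\<^sub>1\<close>. The \<open>e\<^sub>N\<close> form a \<open>\<int>\<close>-basis of the distribution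
  algebra (\<open>carrier_distribution_algebra\<close>), and the isomorphism sends \<open>e\<^sub>N\<close> to \<open>B\<^sub>N\<close>.

  Instead of comparing products of series, the proof compares derivatives. Multiplication by a class
  \<open>d\<close> is a vector field \<open>1 + X \<mapsto> d (1 + X)\<close> on the centre; \<open>inv_deriv d\<close> is the derivative of power
  series along it. It takes \<open>log (1 + X)\<close> to the constant \<open>d\<close>, and so \<open>inv_deriv d B = d \<cdot> B\<close> in the
  enveloping algebra (\<open>inv_deriv_weighted_basis\<close>). Read coefficientwise this is a recursion: a positive
  multiple of \<open>B\<^sub>N\<^sub>+\<^sub>d\<close> is expressed through \<open>d \<cdot> B\<^sub>N\<close> and members of the degree of \<open>N\<close>. In a torsion-free
  group such a recursion has at most one solution with a given value at \<open>0\<close> (\<open>inv_deriv_unique\<close>). The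
  functionals \<open>e\<^sub>N\<close> obey the same recursion, with multiplication by \<open>d\<close> replaced by composition with the
  invariant derivation of \<open>d\<close> on the coordinate ring (\<open>inv_deriv_coord_fun\<close>).

  The rest follows from uniqueness, used twice. Convolution with \<open>g\<close> on the right commutes with the
  invariant derivations (\<open>convolution_inv_derivation\<close>), which is associativity in the centre. Therefore the
  images of \<open>e\<^sub>N * g\<close> and the products of \<open>B\<^sub>N\<close> with the image of \<open>g\<close> solve the same recursion, and the map is
  multiplicative (\<open>weighted_comb_convolution\<close>); in particular the span of the \<open>B\<^sub>N\<close> is a ring. For
  injectivity, the commuting invariant derivations make the enveloping algebra act on rational-valued
  functionals. Applied to the counit, \<open>B\<^sub>N\<close> gives \<open>e\<^sub>N\<close> (\<open>env_act_weighted_basis\<close>), again because both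
  obey one recursion, and the \<open>e\<^sub>N\<close> are independent. The ring axioms
  of the distribution algebra are carried over along the isomorphism.
\<close>

section \<open>Additive maps and pointwise algebra of functions\<close>

lemma sum_fun_apply: "(\<Sum>i\<in>S. F i) x = (\<Sum>i\<in>S. F i x :: 'r::comm_monoid_add)"
  by (induction S rule: infinite_finite_induct) simp_all

lemma of_int_fun_apply: "(of_int k :: 'i \<Rightarrow> 'r::ring_1) x = of_int k"
  by (cases k rule: int_cases2) simp_all

lemma additive_of_int:
  fixes h :: "'r::ring_1 \<Rightarrow> 's::ring_1"
  assumes "additive h"
  shows "h (of_int k * x) = of_int k * h x"
  by (rule additive_int_eqI[of "\<lambda>k. h (of_int k * x)" "\<lambda>k. of_int k * h x"])
    (simp_all add: additive_def algebra_simps additive.add[OF assms])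

lemma additive_of_nat:
  fixes h :: "'r::ring_1 \<Rightarrow> 's::ring_1"
  assumes "additive h"
  shows "h (of_nat k * x) = of_nat k * h x"
  using additive_of_int[OF assms, of "int k"] by simp

lemma additive_compose: "additive h \<Longrightarrow> additive h' \<Longrightarrow> additive (\<lambda>x. h (h' x))"
  by (simp add: additive_def)

section \<open>Structure constants of the centre\<close>

lemma conj_class_of_surj: "\<exists>g. c = conj_class_of g"
proof -
  obtain g where "g \<in> class_elems c"
    using class_elems[of c] conj_self by auto
  then show ?thesis by (auto simp: mem_class_elems_iff)
qed

text \<open>
  The coefficient counts factorisations in the group, so it does not depend on the
  coefficient ring: the integral structure constants also compute products of class sums
  over \<open>\<rat>\<close>.
\<close>

lemma lookup_class_sum_mult_card:
  "Poly_Mapping.lookup (class_sum d * class_sum e :: 'g::{finite,group_add} \<Rightarrow>\<^sub>0 'r::ring_1) g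
    = of_nat (card {h \<in> class_elems d. e = conj_class_of (- h + g)})"
  unfolding class_sum_def[of d]
  by (simp add: sum_distrib_right lookup_sum lookup_single_mult_left lookup_class_sum sum.If_cases)
    (simp add: Int_def)

lemma lookup_class_sum_mult:
  "Poly_Mapping.lookup (class_sum d * class_sum e :: 'g::{finite,group_add} \<Rightarrow>\<^sub>0 'r::ring_1) g
    = of_int (struct_const d e (conj_class_of g))"
proof -
  have "struct_const d e (conj_class_of g)
      = Poly_Mapping.lookup (class_sum d * class_sum e :: 'g \<Rightarrow>\<^sub>0 int) g"
    by (simp only: struct_const lookup_class_combination)
  then show ?thesis
    by (simp only: lookup_class_sum_mult_card of_int_of_nat_eq)
qed

lemma lookup_of_int_mult:
  "Poly_Mapping.lookup (of_int k * x :: 'm::monoid_add \<Rightarrow>\<^sub>0 'r::ring_1) g = of_int k * Poly_Mapping.lookup x g"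
proof -
  have "additive (\<lambda>x :: 'm \<Rightarrow>\<^sub>0 'r. Poly_Mapping.lookup x g)"
    by (simp add: additive_def lookup_add)
  from additive_of_int[OF this] show ?thesis .
qed

lemma class_sum_mult:
  "(class_sum d * class_sum e :: 'g::{finite,group_add} \<Rightarrow>\<^sub>0 'r::ring_1)
    = (\<Sum>c\<in>UNIV. of_int (struct_const d e c) * class_sum c)"
  by (rule poly_mapping_eqI)
    (simp add: lookup_class_sum_mult lookup_sum lookup_of_int_mult lookup_class_sum if_distrib cong: if_cong)

lemma class_sum_combination_cancel:
  assumes "(\<Sum>c\<in>UNIV. of_int (A c) * class_sum c :: 'g::{finite,group_add} \<Rightarrow>\<^sub>0 int)
    = (\<Sum>c\<in>UNIV. of_int (B c) * class_sum c)"
  shows "A c = B c"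
proof -
  obtain g where c: "c = conj_class_of g" using conj_class_of_surj by blast
  then show ?thesis
    using arg_cong[OF assms, of "\<lambda>x. Poly_Mapping.lookup x g"] by (simp only: lookup_class_combination c)
qed

lemma struct_const_commute: "struct_const d e c = struct_const e d c"
proof (rule class_sum_combination_cancel)
  show "(\<Sum>c\<in>UNIV. of_int (struct_const d e c) * class_sum c :: 'a \<Rightarrow>\<^sub>0 int)
    = (\<Sum>c\<in>UNIV. of_int (struct_const e d c) * class_sum c)"
    unfolding struct_const[symmetric] by (rule class_sum_central)
qed

lemma class_sum_class_id: "class_sum class_id = 1"
  by (simp add: class_sum_def class_elems_class_id)

lemma struct_const_id: "struct_const d class_id c = (if c = d then 1 else 0)"
proof (rule class_sum_combination_cancel[of "struct_const d class_id" "\<lambda>c. if c = d then 1 else 0"])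
  have "(\<Sum>c\<in>UNIV. of_int (if c = d then 1 else 0) * class_sum c :: 'a \<Rightarrow>\<^sub>0 int)
      = (\<Sum>c\<in>UNIV. if c = d then class_sum c else 0)"
    by (intro sum.cong) auto
  then show "(\<Sum>c\<in>UNIV. of_int (struct_const d class_id c) * class_sum c :: 'a \<Rightarrow>\<^sub>0 int)
    = (\<Sum>c\<in>UNIV. of_int (if c = d then 1 else 0) * class_sum c)"
    by (simp add: struct_const[symmetric] class_sum_class_id)
qed

lemma struct_const_assoc:
  "(\<Sum>q\<in>UNIV. struct_const d p q * struct_const q r c)
    = (\<Sum>q\<in>UNIV. struct_const p r q * struct_const d q c)"
proof (rule class_sum_combination_cancel[of
      "\<lambda>c. \<Sum>q\<in>UNIV. struct_const d p q * struct_const q r c"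
      "\<lambda>c. \<Sum>q\<in>UNIV. struct_const p r q * struct_const d q c"])
  have 1: "(\<Sum>c\<in>UNIV. of_int (\<Sum>q\<in>UNIV. struct_const d p q * struct_const q r c) * class_sum c)
      = (class_sum d * class_sum p * class_sum r :: 'a \<Rightarrow>\<^sub>0 int)"
  proof -
    have "(class_sum d * class_sum p * class_sum r :: 'a \<Rightarrow>\<^sub>0 int)
        = (\<Sum>q\<in>UNIV. \<Sum>c\<in>UNIV. of_int (struct_const d p q) * (of_int (struct_const q r c) * class_sum c))"
      by (simp add: class_sum_mult[of d p] sum_distrib_right mult.assoc class_sum_mult[of _ r] sum_distrib_left)
    also have "\<dots> = (\<Sum>c\<in>UNIV. \<Sum>q\<in>UNIV. of_int (struct_const d p q) * (of_int (struct_const q r c) * class_sum c))"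
      by (rule sum.swap)
    finally show ?thesis by (simp add: sum_distrib_right mult.assoc)
  qed
  have 2: "(\<Sum>c\<in>UNIV. of_int (\<Sum>q\<in>UNIV. struct_const p r q * struct_const d q c) * class_sum c)
      = (class_sum d * (class_sum p * class_sum r) :: 'a \<Rightarrow>\<^sub>0 int)"
  proof -
    have "(class_sum d * (class_sum p * class_sum r) :: 'a \<Rightarrow>\<^sub>0 int)
        = (\<Sum>q\<in>UNIV. of_int (struct_const p r q) * (class_sum d * class_sum q))"
      unfolding class_sum_mult[of p r] sum_distrib_left
      by (intro sum.cong refl) (metis mult.assoc mult_of_int_commute)
    also have "\<dots> = (\<Sum>q\<in>UNIV. \<Sum>c\<in>UNIV. of_int (struct_const p r q) * (of_int (struct_const d q c) * class_sum c))"
      by (simp add: class_sum_mult[of d] sum_distrib_left)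
    also have "\<dots> = (\<Sum>c\<in>UNIV. \<Sum>q\<in>UNIV. of_int (struct_const p r q) * (of_int (struct_const d q c) * class_sum c))"
      by (rule sum.swap)
    finally show ?thesis by (simp add: sum_distrib_right mult.assoc)
  qed
  show "(\<Sum>c\<in>UNIV. of_int (\<Sum>q\<in>UNIV. struct_const d p q * struct_const q r c) * class_sum c :: 'a \<Rightarrow>\<^sub>0 int)
    = (\<Sum>c\<in>UNIV. of_int (\<Sum>q\<in>UNIV. struct_const p r q * struct_const d q c) * class_sum c)"
    unfolding 1 2 by (rule mult.assoc)
qed

lemma additive_Rep_rat_centre: "additive Rep_rat_centre"
  by (simp add: additive_def plus_rat_centre.rep_eq)

lemma centre_class_mult:
  "centre_class d * centre_class e
    = (\<Sum>c\<in>UNIV. of_int (struct_const d e c) * (centre_class c :: 'g::{finite,group_add} rat_centre))"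
  by (rule Rep_rat_centre_inject[THEN iffD1])
    (simp only: additive.sum[OF additive_Rep_rat_centre] additive_of_int[OF additive_Rep_rat_centre]
      times_rat_centre.rep_eq[of "centre_class d"] centre_class.rep_eq class_sum_mult)

section \<open>Monomials\<close>

definition unit_monom :: "'c \<Rightarrow> 'c \<Rightarrow>\<^sub>0 nat" where
  "unit_monom c = Poly_Mapping.single c 1"

lemma lookup_unit_monom: "Poly_Mapping.lookup (unit_monom c) e = (if c = e then 1 else 0)"
  by (simp add: unit_monom_def lookup_single when_def)

definition mdeg :: "('c::finite \<Rightarrow>\<^sub>0 nat) \<Rightarrow> nat" where
  "mdeg N = (\<Sum>c\<in>UNIV. Poly_Mapping.lookup N c)"

lemma mdeg_0 [simp]: "mdeg 0 = 0"
  by (simp add: mdeg_def)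

lemma mdeg_add [simp]: "mdeg (M + N) = mdeg M + mdeg N"
  by (simp add: mdeg_def lookup_add sum.distrib)

lemma mdeg_unit_monom [simp]: "mdeg (unit_monom c) = 1"
  by (simp add: mdeg_def lookup_unit_monom)

lemma mdeg_keys: "(\<Sum>c\<in>Poly_Mapping.keys N. Poly_Mapping.lookup N c) = mdeg N"
  unfolding mdeg_def by (intro sum.mono_neutral_left) (auto simp: in_keys_iff)

lemma monom_minus_unit:
  "Poly_Mapping.lookup N c > 0 \<Longrightarrow> N - unit_monom c + unit_monom c = N"
  by (rule poly_mapping_eqI) (auto simp: lookup_add lookup_minus lookup_unit_monom)

lemma mdeg_minus_unit: "Poly_Mapping.lookup N c > 0 \<Longrightarrow> Suc (mdeg (N - unit_monom c)) = mdeg N"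
  using mdeg_add[of "N - unit_monom c" "unit_monom c"] by (simp add: monom_minus_unit)

text \<open>
  Induction shaped for the recursion of \<open>inv_deriv\<close>, which expresses a multiple
  of the value at \<open>N + unit_monom c\<close> through values at monomials of the degree
  of \<open>N\<close>.
\<close>

lemma monom_induct [case_names zero step]:
  fixes N :: "'c::finite \<Rightarrow>\<^sub>0 nat"
  assumes "P 0" and "\<And>N c. (\<And>M. mdeg M \<le> mdeg N \<Longrightarrow> P M) \<Longrightarrow> P (N + unit_monom c)"
  shows "P N"
proof (induction "mdeg N" arbitrary: N rule: less_induct)
  case less
  show ?case
  proof (cases "N = 0")
    case False
    then obtain c where c: "Poly_Mapping.lookup N c > 0"
      by (metis gr0I poly_mapping_eqI lookup_zero)
    have "P (N - unit_monom c + unit_monom c)"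
      by (rule assms(2)) (use less mdeg_minus_unit[OF c] in auto)
    then show ?thesis by (simp add: monom_minus_unit[OF c])
  qed (simp add: assms(1))
qed

lemma finite_mdeg_le: "finite {N :: 'c::finite \<Rightarrow>\<^sub>0 nat. mdeg N \<le> n}"
proof -
  define T :: "'c \<Rightarrow>\<^sub>0 nat" where "T = (\<Sum>c\<in>UNIV. Poly_Mapping.single c n)"
  have T: "Poly_Mapping.lookup T c = n" for c
    by (simp add: T_def lookup_sum lookup_single when_def)
  have "N \<in> fst ` {(K, L). K + L = T}" if "mdeg N \<le> n" for N
  proof -
    have "Poly_Mapping.lookup N c \<le> n" for c
      using that member_le_sum[of c UNIV "Poly_Mapping.lookup N"] by (simp add: mdeg_def)
    then have "N + (T - N) = T"
      by (intro poly_mapping_eqI) (simp add: lookup_add lookup_minus T)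
    then show ?thesis by force
  qed
  then show ?thesis
    by (intro finite_subset[OF _ finite_imageI[OF finite_antidiagonal[of T]]]) auto
qed

section \<open>Invariant derivations of power series\<close>

definition mps_partial :: "'c \<Rightarrow> ('c, 'r::semiring_1) mps \<Rightarrow> ('c, 'r) mps" where
  "mps_partial c f N = of_nat (Suc (Poly_Mapping.lookup N c)) * f (N + unit_monom c)"

definition mps_shift :: "'c \<Rightarrow> ('c, 'r::zero) mps \<Rightarrow> ('c, 'r) mps" where
  "mps_shift c f N = (if Poly_Mapping.lookup N c > 0 then f (N - unit_monom c) else 0)"

lemma additive_mps_mult:
  fixes f g :: "('c, 'r::ring_1) mps"
  shows "additive (\<lambda>f. mps_mult f g)" "additive (\<lambda>g. mps_mult f g)"
  by (simp_all add: additive_def mps_mult_def fun_eq_iff split_def algebra_simps sum.distrib)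

lemma additive_mps_partial: "additive (mps_partial c :: ('c, 'r::ring_1) mps \<Rightarrow> _)"
  by (simp add: additive_def mps_partial_def fun_eq_iff algebra_simps)

lemma additive_mps_shift: "additive (mps_shift c :: ('c, 'r::ring_1) mps \<Rightarrow> _)"
  by (simp add: additive_def mps_shift_def fun_eq_iff)

text \<open>
  Terms in which \<open>c\<close> does not divide the left factor vanish; in all others one
  factor \<open>c\<close> can be taken out of it.
\<close>

lemma sum_antidiagonal_left:
  assumes "\<And>K L. Poly_Mapping.lookup K c = 0 \<Longrightarrow> \<phi> K L = 0"
  shows "(\<Sum>(K, L) | K + L = N + unit_monom c. \<phi> K L) = (\<Sum>(K, L) | K + L = N. \<phi> (K + unit_monom c) L)"
proof -
  let ?h = "\<lambda>(K, L). (K + unit_monom c, L :: 'a \<Rightarrow>\<^sub>0 nat)"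
  have "(\<Sum>(K, L) | K + L = N + unit_monom c. \<phi> K L) = (\<Sum>(K, L) \<in> ?h ` {(K, L). K + L = N}. \<phi> K L)"
  proof (rule sum.mono_neutral_right)
    show "finite {(K, L). K + L = N + unit_monom c}" by (rule finite_antidiagonal)
    show "?h ` {(K, L). K + L = N} \<subseteq> {(K, L). K + L = N + unit_monom c}"
      by (auto simp: algebra_simps)
    show "\<forall>x\<in>{(K, L). K + L = N + unit_monom c} - ?h ` {(K, L). K + L = N}. (case x of (K, L) \<Rightarrow> \<phi> K L) = 0"
    proof clarify
      fix K L assume eq: "K + L = N + unit_monom c" and ni: "(K, L) \<notin> ?h ` {(K, L). K + L = N}"
      have "Poly_Mapping.lookup K c = 0"
      proof (rule ccontr)
        assume "Poly_Mapping.lookup K c \<noteq> 0"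
        then have K: "K - unit_monom c + unit_monom c = K" by (simp add: monom_minus_unit)
        have "(K - unit_monom c + L) + unit_monom c = N + unit_monom c"
          using K eq by (metis add.assoc add.commute)
        then have "K - unit_monom c + L = N" by simp
        then show False using ni K by force
      qed
      then show "\<phi> K L = 0" by (rule assms)
    qed
  qed
  also have "\<dots> = (\<Sum>(K, L) | K + L = N. \<phi> (K + unit_monom c) L)"
    by (subst sum.reindex) (auto simp: inj_on_def intro!: sum.cong)
  finally show ?thesis .
qed

lemma sum_antidiagonal_swap:
  "(\<Sum>(K, L) | K + L = N. \<phi> K L) = (\<Sum>(K, L) | K + L = N. \<phi> L K)"
  for N :: "'c \<Rightarrow>\<^sub>0 nat"
  by (rule sum.reindex_bij_witness[of _ prod.swap prod.swap]) (auto simp: add.commute)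

lemma sum_antidiagonal_right:
  assumes "\<And>K L. Poly_Mapping.lookup L c = 0 \<Longrightarrow> \<phi> K L = 0"
  shows "(\<Sum>(K, L) | K + L = N + unit_monom c. \<phi> K L) = (\<Sum>(K, L) | K + L = N. \<phi> K (L + unit_monom c))"
proof -
  have "(\<Sum>(K, L) | K + L = N + unit_monom c. \<phi> L K) = (\<Sum>(K, L) | K + L = N. \<phi> L (K + unit_monom c))"
    by (rule sum_antidiagonal_left) (rule assms)
  then show ?thesis
    by (simp only: sum_antidiagonal_swap[of \<phi>] sum_antidiagonal_swap[of "\<lambda>K L. \<phi> K (L + unit_monom c)"])
qed

lemma mps_partial_mult:
  fixes f g :: "('c, 'r::ring_1) mps"
  shows "mps_partial c (mps_mult f g) = mps_mult (mps_partial c f) g + mps_mult f (mps_partial c g)"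
proof
  fix N
  have "mps_partial c (mps_mult f g) N
      = (\<Sum>(K, L) | K + L = N + unit_monom c.
          of_nat (Poly_Mapping.lookup K c) * f K * g L + f K * (of_nat (Poly_Mapping.lookup L c) * g L))"
  proof -
    have "of_nat (Suc (Poly_Mapping.lookup N c)) * (f K * g L)
        = of_nat (Poly_Mapping.lookup K c) * f K * g L + f K * (of_nat (Poly_Mapping.lookup L c) * g L)"
      if "K + L = N + unit_monom c" for K L
    proof -
      have "Suc (Poly_Mapping.lookup N c) = Poly_Mapping.lookup K c + Poly_Mapping.lookup L c"
        using arg_cong[OF that, of "\<lambda>M. Poly_Mapping.lookup M c"]
        by (simp add: lookup_add lookup_unit_monom)
      moreover have "of_nat n * (f K * g L) = f K * (of_nat n * g L)" for n
        by (metis mult.assoc mult_of_nat_commute)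
      ultimately show ?thesis
        by (simp only: of_nat_add distrib_right mult.assoc)
    qed
    then show ?thesis
      by (auto simp: mps_partial_def mps_mult_def sum_distrib_left simp del: of_nat_Suc intro!: sum.cong)
  qed
  also have "\<dots> = (\<Sum>(K, L) | K + L = N + unit_monom c. of_nat (Poly_Mapping.lookup K c) * f K * g L)
      + (\<Sum>(K, L) | K + L = N + unit_monom c. f K * (of_nat (Poly_Mapping.lookup L c) * g L))"
    by (simp add: split_def sum.distrib)
  also have "\<dots> = mps_mult (mps_partial c f) g N + mps_mult f (mps_partial c g) N"
    by (subst sum_antidiagonal_left, simp, subst sum_antidiagonal_right, simp)
      (simp add: mps_mult_def mps_partial_def lookup_add lookup_unit_monom)
  finally show "mps_partial c (mps_mult f g) N
      = (mps_mult (mps_partial c f) g + mps_mult f (mps_partial c g)) N" by simp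
qed

lemma
  fixes f g :: "('c, 'r::ring_1) mps"
  shows mps_shift_mult_left: "mps_shift c (mps_mult f g) = mps_mult (mps_shift c f) g"
    and mps_shift_mult_right: "mps_shift c (mps_mult f g) = mps_mult f (mps_shift c g)"
proof -
  have "mps_shift c (mps_mult f g) N = mps_mult (mps_shift c f) g N
      \<and> mps_shift c (mps_mult f g) N = mps_mult f (mps_shift c g) N" for N
  proof (cases "Poly_Mapping.lookup N c > 0")
    case True
    define M where "M = N - unit_monom c"
    have N: "N = M + unit_monom c"
      unfolding M_def by (rule monom_minus_unit[OF True, symmetric])
    have "mps_mult (mps_shift c f) g N = mps_mult f g M" "mps_mult f (mps_shift c g) N = mps_mult f g M"
      unfolding mps_mult_def N
      by (subst sum_antidiagonal_left, simp add: mps_shift_def,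
          simp add: mps_shift_def lookup_add lookup_unit_monom)
        (subst sum_antidiagonal_right, simp add: mps_shift_def,
          simp add: mps_shift_def lookup_add lookup_unit_monom)
    then show ?thesis using True by (simp add: mps_shift_def[of c "mps_mult f g"] M_def)
  next
    case False
    then have "Poly_Mapping.lookup K c = 0 \<and> Poly_Mapping.lookup L c = 0" if "K + L = N" for K L
      using that by (auto simp: lookup_add)
    then show ?thesis using False
      by (auto simp: mps_mult_def mps_shift_def intro!: sum.neutral)
  qed
  then show "mps_shift c (mps_mult f g) = mps_mult (mps_shift c f) g"
    and "mps_shift c (mps_mult f g) = mps_mult f (mps_shift c g)" by auto
qed

text \<open>
  The point \<open>1 + X\<close>, with \<open>X = \<Sum>c. c x\<^sub>c\<close>, is moved by
  the multiplicative vector field of the class \<open>d\<close> with velocity \<open>(1 + X)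
  d = d + \<Sum>e c. A\<^sub>d\<^sub>e\<^sup>c x\<^sub>e c\<close>. Hence the derivative
  along this field is \<open>\<partial>\<^sub>d + \<Sum>c e. A\<^sub>d\<^sub>e\<^sup>c
  x\<^sub>e \<partial>\<^sub>c\<close>, with \<open>\<partial>\<^sub>c\<close> and
  multiplication by \<open>x\<^sub>e\<close> rendered by \<^const>\<open>mps_partial\<close>
  and \<^const>\<open>mps_shift\<close>. The operator is also applied to families of
  functionals or of polynomials indexed by monomials, where it encodes a recursion.
\<close>

definition inv_deriv ::
    "'g::{finite,group_add} conj_class \<Rightarrow> ('g conj_class, 'r::ring_1) mps \<Rightarrow> ('g conj_class, 'r) mps" where
  "inv_deriv d f = mps_partial d f
     + (\<Sum>c\<in>UNIV. \<Sum>e\<in>UNIV. of_int (struct_const d e c) * mps_shift e (mps_partial c f))"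

lemma inv_deriv_apply:
  "inv_deriv d f N = of_nat (Suc (Poly_Mapping.lookup N d)) * f (N + unit_monom d)
     + (\<Sum>c\<in>UNIV. \<Sum>e\<in>UNIV. of_int (struct_const d e c) * mps_shift e (mps_partial c f) N)"
  by (simp add: inv_deriv_def mps_partial_def sum_fun_apply of_int_fun_apply)

lemma additive_inv_deriv: "additive (inv_deriv d)"
  by (simp add: additive_def inv_deriv_def additive.add[OF additive_mps_partial]
      additive.add[OF additive_mps_shift] algebra_simps sum.distrib)

lemma inv_deriv_mult:
  "inv_deriv d (mps_mult f g) = mps_mult (inv_deriv d f) g + mps_mult f (inv_deriv d g)"
  by (simp add: inv_deriv_def mps_partial_mult additive.add[OF additive_mps_shift]
      additive.add[OF additive_mps_mult(1)] additive.add[OF additive_mps_mult(2)]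
      additive.sum[OF additive_mps_mult(1)] additive.sum[OF additive_mps_mult(2)]
      additive_of_int[OF additive_mps_mult(1)] additive_of_int[OF additive_mps_mult(2)]
      mps_shift_mult_left[of _ "mps_partial _ f" g] mps_shift_mult_right[of _ f "mps_partial _ g"]
      algebra_simps sum.distrib)

text \<open>
  The operator has integral coefficients, and additive maps are linear over
  \<open>\<int>\<close>.
\<close>

lemma additive_inv_deriv_comp:
  fixes h :: "'r::ring_1 \<Rightarrow> 's::ring_1"
  assumes "additive h"
  shows "h (inv_deriv d f N) = inv_deriv d (\<lambda>N. h (f N)) N"
proof -
  have "h (mps_shift e (mps_partial c f) N) = mps_shift e (mps_partial c (\<lambda>N. h (f N))) N" for c e
    by (simp add: mps_shift_def mps_partial_def additive_of_nat[OF assms] additive.zero[OF assms]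
        del: of_nat_Suc)
  then show ?thesis
    by (simp add: inv_deriv_apply additive.add[OF assms] additive.sum[OF assms]
        additive_of_int[OF assms] additive_of_nat[OF assms] del: of_nat_Suc)
qed

lemma mps_shift_partial_cong:
  assumes "\<And>M. mdeg M = mdeg N \<Longrightarrow> f M = g M"
  shows "mps_shift e (mps_partial c f) N = mps_shift e (mps_partial c g) N"
  using mdeg_minus_unit[of N e] by (auto simp: mps_shift_def mps_partial_def assms)

lemma inv_deriv_cong:
  assumes "\<And>M. mdeg M \<le> Suc (mdeg N) \<Longrightarrow> f M = g M"
  shows "inv_deriv d f N = inv_deriv d g N"
proof -
  have "mps_shift e (mps_partial c f) N = mps_shift e (mps_partial c g) N" for c e
    by (rule mps_shift_partial_cong) (simp add: assms)
  then show ?thesis by (simp add: inv_deriv_apply assms)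
qed

text \<open>
  If \<open>inv_deriv d\<close> acts on a family \<open>u\<close> through some map of its
  values, then \<open>(N\<^sub>d + 1) u(N + d)\<close> is determined by values of
  \<open>u\<close> in the degree of \<open>N\<close>. In the absence of torsion the value at
  \<open>0\<close> therefore determines the family.
\<close>

lemma inv_deriv_unique:
  fixes u v :: "('g::{finite,group_add} conj_class, 'r::ring_1) mps"
  assumes u: "\<And>d N. inv_deriv d u N = p d (u N)" and v: "\<And>d N. inv_deriv d v N = p d (v N)"
    and 0: "u 0 = v 0"
    and torsion_free: "\<And>n (x::'r) y. of_nat (Suc n) * x = of_nat (Suc n) * y \<Longrightarrow> x = y"
  shows "u N = v N"
proof (induction N rule: monom_induct)
  case zero
  show ?case by (rule 0)
next
  case (step N d)
  have "mps_shift e (mps_partial c u) N = mps_shift e (mps_partial c v) N" for c e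
    by (rule mps_shift_partial_cong) (simp add: step)
  moreover have "inv_deriv d u N = inv_deriv d v N"
    by (simp add: u v step)
  ultimately have "of_nat (Suc (Poly_Mapping.lookup N d)) * u (N + unit_monom d)
      = of_nat (Suc (Poly_Mapping.lookup N d)) * v (N + unit_monom d)"
    by (simp add: inv_deriv_apply del: of_nat_Suc)
  then show ?case by (rule torsion_free)
qed

section \<open>The logarithm of the generic unit\<close>

lemma additive_scaleQ: "additive (scaleQ a :: 'r::rat_vector \<Rightarrow> 'r)"
  by (simp add: additive_def scaleQ_add_right)

lemma scaleQ_of_nat: "of_nat n *\<^sub>Q x = of_nat n * x" for x :: "'r::rat_algebra_1"
proof (induction n)
  case 0
  show ?case using scaleQ_add_left[of 0 0 x] by simp
qed (simp add: scaleQ_add_left scaleQ_one algebra_simps)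

lemma scaleQ_0_right: "a *\<^sub>Q (0 :: 'r::rat_vector) = 0"
  by (rule additive.zero[OF additive_scaleQ])

lemma rat_algebra_torsion_free:
  fixes x y :: "'r::rat_algebra_1"
  assumes "of_nat (Suc n) * x = of_nat (Suc n) * y"
  shows "x = y"
proof -
  have "(1 / of_nat (Suc n)) *\<^sub>Q (of_nat (Suc n) *\<^sub>Q z) = z" for z :: 'r
    by (simp add: scaleQ_scaleQ scaleQ_one del: of_nat_Suc)
  then show ?thesis using assms by (metis scaleQ_of_nat)
qed

lemma mps_mult_const_left: "mps_mult (\<lambda>N. a * f N) g = (\<lambda>N. a * mps_mult f g N)"
  by (simp add: fun_eq_iff mps_mult_def sum_distrib_left split_def mult.assoc)

lemma mps_mult_const_right:
  assumes "\<And>N. a * f N = f N * a"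
  shows "mps_mult f (\<lambda>N. a * g N) = (\<lambda>N. a * mps_mult f g N)"
proof -
  have "f K * (a * g L) = a * (f K * g L)" for K L
    by (metis assms mult.assoc)
  then show ?thesis by (simp add: fun_eq_iff mps_mult_def sum_distrib_left split_def)
qed

lemma mps_mult_one: "mps_mult (mps_power h 0) g = g" for g :: "('c, 'r::semiring_1) mps"
proof
  fix N
  have "mps_mult (mps_power h 0) g N = (\<Sum>x\<in>{(K, L). K + L = N}. if x = (0, N) then g N else 0)"
    unfolding mps_mult_def by (intro sum.cong) (auto split: if_split_asm)
  also have "\<dots> = g N"
    by (simp add: finite_antidiagonal)
  finally show "mps_mult (mps_power h 0) g N = g N" .
qed

lemma mps_power_vanish: "f 0 = 0 \<Longrightarrow> mdeg N < k \<Longrightarrow> mps_power f k N = 0"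
  by (rule mps_power_eq_0) (simp_all only: mdeg_keys)

lemma mps_exp_truncate:
  assumes "f 0 = 0" "mdeg N < n"
  shows "mps_exp f N = (\<Sum>k<n. (1 / fact k) *\<^sub>Q mps_power f k N)"
  unfolding mps_exp_def using assms
  by (intro Sum_any.expand_superset)
    (auto simp: not_less[symmetric] mps_power_vanish scaleQ_0_right intro: ccontr)

lemma mps_log1p_truncate:
  assumes "f 0 = 0" "mdeg N \<le> n"
  shows "mps_log1p f N = (\<Sum>k<n. ((-1) ^ k / of_nat (Suc k)) *\<^sub>Q mps_power f (Suc k) N)"
  unfolding mps_log1p_def
proof (rule Sum_any.expand_superset)
  show "{k. ((-1) ^ k / of_nat (Suc k)) *\<^sub>Q mps_power f (Suc k) N \<noteq> 0} \<subseteq> {..<n}"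
  proof
    fix k assume "k \<in> {k. ((-1) ^ k / of_nat (Suc k)) *\<^sub>Q mps_power f (Suc k) N \<noteq> 0}"
    then have "mps_power f (Suc k) N \<noteq> 0" by (auto simp: scaleQ_0_right)
    then have "\<not> mdeg N < Suc k" using mps_power_vanish[of f N "Suc k"] assms(1) by blast
    then show "k \<in> {..<n}" using assms(2) by simp
  qed
qed simp

lemma unit_monom_neq_0: "unit_monom c \<noteq> 0"
  by (metis lookup_unit_monom lookup_zero zero_neq_one)

lemma class_series_eq:
  "class_series = (\<lambda>N. \<Sum>c\<in>UNIV. if N = unit_monom c then centre_class c else 0)"
  by (simp add: class_series_def unit_monom_def fun_eq_iff)

lemma class_series_0: "class_series 0 = 0"
  by (simp add: class_series_eq unit_monom_neq_0[symmetric])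

lemma add_unit_monom_eq_unit_monom: "N + unit_monom c = unit_monom e \<longleftrightarrow> N = 0 \<and> c = e"
proof
  assume eq: "N + unit_monom c = unit_monom e"
  have "c = e"
    using arg_cong[OF eq, of "\<lambda>M. Poly_Mapping.lookup M c"]
    by (simp add: lookup_add lookup_unit_monom split: if_splits)
  then show "N = 0 \<and> c = e" using eq by simp
qed simp

lemma minus_unit_monom_eq_0:
  "Poly_Mapping.lookup N e > 0 \<and> N - unit_monom e = 0 \<longleftrightarrow> N = unit_monom e"
  by (metis add_0 lookup_unit_monom monom_minus_unit zero_less_one cancel_comm_monoid_add_class.diff_cancel)

text \<open>
  A linear form \<open>\<Sum>c. a\<^sub>c x\<^sub>c\<close> is sent to \<open>a\<^sub>d +
  \<Sum>e c. A\<^sub>d\<^sub>e\<^sup>c a\<^sub>c x\<^sub>e\<close>. It is used for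
  \<open>X\<close> itself, where \<open>a\<^sub>c = c\<close>, and for a single variable.
\<close>

lemma inv_deriv_linear:
  fixes a :: "'g::{finite,group_add} conj_class \<Rightarrow> 'r::ring_1"
  assumes "f = (\<lambda>N. \<Sum>c\<in>UNIV. if N = unit_monom c then a c else 0)"
  shows "inv_deriv d f N = (if N = 0 then a d else 0)
    + (\<Sum>e\<in>UNIV. if N = unit_monom e then (\<Sum>c\<in>UNIV. of_int (struct_const d e c) * a c) else 0)"
proof -
  have partial: "mps_partial c f = (\<lambda>N. if N = 0 then a c else 0)" for c
  proof
    fix N
    have "f (N + unit_monom c) = (if N = 0 then a c else 0)"
      by (simp add: assms add_unit_monom_eq_unit_monom)
    then show "mps_partial c f N = (if N = 0 then a c else 0)"
      by (simp add: mps_partial_def)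
  qed
  have shift: "mps_shift e (mps_partial c f) N = (if N = unit_monom e then a c else 0)" for e c
    using minus_unit_monom_eq_0[of N e] by (auto simp: mps_shift_def partial)
  have "(\<Sum>c\<in>UNIV. \<Sum>e\<in>UNIV. of_int (struct_const d e c) * mps_shift e (mps_partial c f) N)
      = (\<Sum>e\<in>UNIV. \<Sum>c\<in>UNIV. of_int (struct_const d e c) * mps_shift e (mps_partial c f) N)"
    by (rule sum.swap)
  also have "\<dots> = (\<Sum>e\<in>UNIV. if N = unit_monom e then (\<Sum>c\<in>UNIV. of_int (struct_const d e c) * a c) else 0)"
    by (intro sum.cong) (auto simp: shift)
  finally show ?thesis
    by (simp add: inv_deriv_def sum_fun_apply of_int_fun_apply partial)
qed

text \<open>
  The vector field is \<open>X \<mapsto> d (1 + X)\<close> by construction.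
\<close>

lemma inv_deriv_class_series:
  "inv_deriv d class_series
    = (\<lambda>N. centre_class d * (mps_power class_series 0 N + class_series N))"
proof
  fix N
  show "inv_deriv d class_series N
    = centre_class d * (mps_power class_series 0 N + class_series N)"
    unfolding inv_deriv_linear[OF class_series_eq]
    by (simp add: class_series_eq distrib_left sum_distrib_left if_distrib[of "\<lambda>x. _ * x"]
        centre_class_mult cong: if_cong)
qed

lemma inv_deriv_class_series_power:
  "inv_deriv d (mps_power class_series (Suc k)) N
    = of_nat (Suc k) * (centre_class d * (mps_power class_series k N + mps_power class_series (Suc k) N))"
proof -
  let ?X = "class_series :: ('a conj_class, 'a rat_centre) mps"
  let ?c = "centre_class d"
  have "inv_deriv d (mps_power ?X (Suc k))
    = (\<lambda>N. of_nat (Suc k) * (?c * (mps_power ?X k N + mps_power ?X (Suc k) N)))"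
  proof (induction k)
    case 0
    have "mps_power ?X (Suc 0) = ?X"
    proof -
      have "mps_mult ?X (mps_power ?X 0) = mps_mult (mps_power ?X 0) ?X"
        by (rule ext) (simp only: mps_mult_def sum_antidiagonal_swap[of "\<lambda>K L. ?X K * mps_power ?X 0 L"] mult.commute)
      then show ?thesis by (simp only: mps_power.simps(2) mps_mult_one)
    qed
    then show ?case by (simp add: inv_deriv_class_series)
  next
    case (Suc k)
    let ?P = "\<lambda>k. mps_power ?X k"
    have left: "mps_mult (inv_deriv d ?X) (?P (Suc k)) = (\<lambda>N. ?c * (?P (Suc k) N + ?P (Suc (Suc k)) N))"
    proof -
      have "mps_mult (inv_deriv d ?X) (?P (Suc k))
          = (\<lambda>N. ?c * mps_mult (?P 0 + ?X) (?P (Suc k)) N)"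
        by (simp only: inv_deriv_class_series mps_mult_const_left[of ?c "?P 0 + ?X", symmetric] plus_fun_apply)
      also have "mps_mult (?P 0 + ?X) (?P (Suc k)) = ?P (Suc k) + ?P (Suc (Suc k))"
        by (simp only: additive.add[OF additive_mps_mult(1)] mps_mult_one mps_power.simps(2)[of ?X "Suc k"])
      finally show ?thesis by simp
    qed
    have "mps_mult ?X (inv_deriv d (?P (Suc k)))
        = (\<lambda>N. of_nat (Suc k) * (?c * mps_mult ?X (?P k + ?P (Suc k)) N))"
    proof -
      have "inv_deriv d (?P (Suc k)) = (\<lambda>N. (of_nat (Suc k) * ?c) * (?P k + ?P (Suc k)) N)"
        unfolding Suc.IH by (simp add: mult.assoc)
      then show ?thesis
        by (simp only: mps_mult_const_right[of "of_nat (Suc k) * ?c" ?X, OF mult.commute])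
          (simp only: mult.assoc)
    qed
    also have "mps_mult ?X (?P k + ?P (Suc k)) = ?P (Suc k) + ?P (Suc (Suc k))"
      by (simp only: additive.add[OF additive_mps_mult(2)] mps_power.simps(2)[symmetric])
    finally have right: "mps_mult ?X (inv_deriv d (?P (Suc k)))
        = (\<lambda>N. of_nat (Suc k) * (?c * (?P (Suc k) N + ?P (Suc (Suc k)) N)))" by simp
    have "inv_deriv d (?P (Suc (Suc k))) = mps_mult (inv_deriv d ?X) (?P (Suc k)) + mps_mult ?X (inv_deriv d (?P (Suc k)))"
      by (simp only: mps_power.simps(2)[of ?X "Suc k"] inv_deriv_mult)
    also have "\<dots> = (\<lambda>N. of_nat (Suc (Suc k)) * (?c * (?P (Suc k) N + ?P (Suc (Suc k)) N)))"
      unfolding left right by (simp add: fun_eq_iff distrib_right del: mps_power.simps)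
    finally show ?case .
  qed
  then show ?thesis by simp
qed

text \<open>
  The chain rule gives \<open>(1 + X)\<inverse> \<cdot> d (1 + X) = d\<close>. In a fixed
  degree the logarithm is a finite sum, and on it the derivatives \<open>(-1)\<^sup>k d
  (X\<^sup>k + X\<^sup>k\<^sup>+\<^sup>1)\<close> telescope.
\<close>

lemma inv_deriv_log_class_series:
  "inv_deriv d (mps_log1p class_series) N = (if N = 0 then centre_class d else 0)"
proof -
  let ?X = "class_series :: ('a conj_class, 'a rat_centre) mps"
  let ?n = "Suc (mdeg N)"
  let ?F = "\<lambda>k N. ((-1) ^ k / of_nat (Suc k)) *\<^sub>Q mps_power ?X (Suc k) N"
  let ?G = "\<lambda>k. (- 1) ^ k * (centre_class d * mps_power ?X k N)"
  have "inv_deriv d (mps_log1p ?X) N = inv_deriv d (\<Sum>k<?n. ?F k) N"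
    by (rule inv_deriv_cong) (simp add: mps_log1p_truncate[where f = class_series, OF class_series_0] sum_fun_apply)
  also have "\<dots> = (\<Sum>k<?n. inv_deriv d (?F k) N)"
    by (simp only: additive.sum[OF additive_inv_deriv] sum_fun_apply)
  also have "\<dots> = (\<Sum>k<?n. ?G k - ?G (Suc k))"
  proof (rule sum.cong)
    fix k
    have "inv_deriv d (?F k) N = ((-1) ^ k / of_nat (Suc k)) *\<^sub>Q inv_deriv d (mps_power ?X (Suc k)) N"
      by (rule additive_inv_deriv_comp[OF additive_scaleQ, symmetric])
    also have "\<dots> = ((-1) ^ k / of_nat (Suc k) * of_nat (Suc k)) *\<^sub>Q
        (centre_class d * (mps_power ?X k N + mps_power ?X (Suc k) N))"
      by (simp only: inv_deriv_class_series_power scaleQ_of_nat[symmetric] scaleQ_scaleQ)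
    also have "(-1) ^ k / of_nat (Suc k) * of_nat (Suc k) = ((-1) ^ k :: rat)"
      by (simp del: of_nat_Suc)
    also have "(-1) ^ k *\<^sub>Q x = (-1) ^ k * x" for x :: "'a rat_centre"
    proof (cases "even k")
      case False
      have "additive (\<lambda>a. a *\<^sub>Q x)" by (simp add: additive_def scaleQ_add_left)
      then have "(- 1) *\<^sub>Q x = - (1 *\<^sub>Q x)" by (rule additive.minus)
      then show ?thesis using False by (simp add: scaleQ_one)
    qed (simp add: scaleQ_one)
    finally show "inv_deriv d (?F k) N = ?G k - ?G (Suc k)"
      by (simp add: algebra_simps)
  qed simp
  also have "\<dots> = ?G 0 - ?G ?n"
    by (rule sum_lessThan_telescope')
  also have "mps_power ?X ?n N = 0"
    by (rule mps_power_vanish[where f = class_series, OF class_series_0]) simp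
  finally show ?thesis by simp
qed

section \<open>The weighted basis\<close>

lemma additive_env_incl: "additive (env_incl :: 'l::rat_lie_algebra \<Rightarrow> _)"
  unfolding additive_def
proof (intro allI, transfer)
  fix x y :: 'l
  have "free_gen (x + y) - free_gen x - free_gen y \<in> env_relators"
    unfolding env_relators_def by blast
  then have "free_gen (x + y) - free_gen x - free_gen y \<in> env_ideal"
    unfolding env_ideal_def using ring.genideal_self[OF ring_ring_of_type_algebra, of env_relators] by auto
  then show "free_gen (x + y) - (free_gen x + free_gen y) \<in> env_ideal"
    by (simp add: algebra_simps)
qed

lemma env_incl_commute: "env_incl x * env_incl y = env_incl y * env_incl x"
  for x y :: "'g::group_add rat_centre"
proof (transfer)
  fix x y :: "'g rat_centre"
  have gen: "env_relators \<subseteq> (env_ideal :: ('g rat_centre free_word \<Rightarrow>\<^sub>0 rat) set)"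
    unfolding env_ideal_def by (rule ring.genideal_self[OF ring_ring_of_type_algebra]) simp
  have "free_gen x * free_gen y - free_gen y * free_gen x - free_gen (lie_bracket x y) \<in> env_ideal"
    using gen unfolding env_relators_def by blast
  moreover have "free_gen (0 + 0) - free_gen 0 - free_gen 0 \<in> (env_ideal :: ('g rat_centre free_word \<Rightarrow>\<^sub>0 rat) set)"
    using gen unfolding env_relators_def by blast
  ultimately have "(free_gen x * free_gen y - free_gen y * free_gen x - free_gen (lie_bracket x y))
      + - (free_gen (0 + 0) - free_gen 0 - free_gen 0) \<in> (env_ideal :: ('g rat_centre free_word \<Rightarrow>\<^sub>0 rat) set)"
    by (intro env_ideal_closed env_ideal_uminus)
  then show "free_gen x * free_gen y - free_gen y * free_gen x \<in> env_ideal"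
    by (simp add: lie_bracket_rat_centre_def)
qed

lemma weighted_basis_0: "weighted_basis 0 = 1"
proof -
  have L0: "env_incl (mps_log1p class_series 0) = 0"
    by (simp add: mps_log1p_truncate[where f = class_series, OF class_series_0, where N = 0 and n = 0] additive.zero[OF additive_env_incl])
  show ?thesis
    unfolding weighted_basis_def
    by (subst mps_exp_truncate[where n = 1]) (simp_all add: L0 scaleQ_one)
qed

text \<open>
  Let \<open>L\<close> be the image of \<open>log (1 + X)\<close> in the enveloping algebra.
  Its derivative is the constant \<open>env_incl d\<close>, which commutes with
  \<open>L\<close> because the Lie algebra is abelian; so the derivative of \<open>exp
  L\<close> is \<open>env_incl d \<cdot> exp L\<close>.
\<close>

lemma inv_deriv_weighted_basis:
  "inv_deriv d weighted_basis N = env_incl (centre_class d) * weighted_basis N"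
proof -
  define L :: "('a conj_class, 'a rat_centre enveloping) mps"
    where "L = (\<lambda>N. env_incl (mps_log1p class_series N))"
  let ?c = "env_incl (centre_class d)"
  have L0: "L 0 = 0"
    by (simp add: L_def mps_log1p_truncate[where f = class_series, OF class_series_0, where N = 0 and n = 0] additive.zero[OF additive_env_incl])
  have DL: "inv_deriv d L = (\<lambda>N. ?c * mps_power L 0 N)"
    unfolding L_def additive_inv_deriv_comp[OF additive_env_incl, symmetric, abs_def]
    by (simp add: fun_eq_iff inv_deriv_log_class_series additive.zero[OF additive_env_incl])
  have comm: "?c * L N = L N * ?c" for N
    unfolding L_def by (rule env_incl_commute)
  have zero: "inv_deriv d (mps_power L 0) N = 0" for N
  proof -
    have "mps_partial c (mps_power L 0) = 0" for c
    proof
      fix N :: "'a conj_class \<Rightarrow>\<^sub>0 nat"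
      have "N + unit_monom c \<noteq> 0"
        using mdeg_add[of N "unit_monom c"] by fastforce
      then show "mps_partial c (mps_power L 0) N = 0 N" by (simp add: mps_partial_def)
    qed
    then show ?thesis
      by (simp add: inv_deriv_def additive.zero[OF additive_mps_shift])
  qed
  have power: "inv_deriv d (mps_power L (Suc k)) = (\<lambda>N. of_nat (Suc k) * (?c * mps_power L k N))" for k
  proof (induction k)
    case 0
    have "inv_deriv d (mps_power L (Suc 0))
        = mps_mult (inv_deriv d L) (mps_power L 0) + mps_mult L (inv_deriv d (mps_power L 0))"
      by (simp only: mps_power.simps(2) inv_deriv_mult)
    also have "inv_deriv d (mps_power L 0) = 0"
      by (rule ext) (simp only: zero zero_fun_apply)
    also have "mps_mult L 0 = 0"
      by (rule additive.zero[OF additive_mps_mult(2)])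
    finally show ?case
      by (simp add: DL mps_mult_const_left mps_mult_one del: mps_power.simps)
  next
    case (Suc k)
    have "inv_deriv d (mps_power L (Suc (Suc k)))
        = mps_mult (inv_deriv d L) (mps_power L (Suc k)) + mps_mult L (inv_deriv d (mps_power L (Suc k)))"
      by (simp only: mps_power.simps(2)[of L "Suc k"] inv_deriv_mult)
    also have "mps_mult (inv_deriv d L) (mps_power L (Suc k)) = (\<lambda>N. ?c * mps_power L (Suc k) N)"
      by (simp only: DL mps_mult_const_left mps_mult_one)
    also have "mps_mult L (inv_deriv d (mps_power L (Suc k)))
        = (\<lambda>N. of_nat (Suc k) * (?c * mps_power L (Suc k) N))"
    proof -
      have "of_nat (Suc k) * ?c * L N = L N * (of_nat (Suc k) * ?c)" for N
        by (metis comm mult.assoc mult_of_nat_commute)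
      from mps_mult_const_right[OF this, where g = "mps_power L k"] show ?thesis
        unfolding Suc.IH by (simp only: mps_power.simps(2)[of L k] mult.assoc)
    qed
    finally show ?case
      by (simp add: fun_eq_iff distrib_right del: mps_power.simps)
  qed
  \<comment> \<open>\<^const>\<open>inv_deriv\<close> looks one degree higher, and the derivative of a power has one factor less.\<close>
  let ?n = "Suc (Suc (mdeg N))"
  let ?F = "\<lambda>k N. (1 / fact k) *\<^sub>Q mps_power L k N"
  have F: "inv_deriv d (?F k) N = (1 / fact k) *\<^sub>Q inv_deriv d (mps_power L k) N" for k
    by (rule additive_inv_deriv_comp[OF additive_scaleQ, symmetric])
  have "inv_deriv d (mps_exp L) N = inv_deriv d (\<Sum>k<?n. ?F k) N"
    by (rule inv_deriv_cong) (simp add: mps_exp_truncate[where f = L, OF L0, where n = ?n] sum_fun_apply del: sum.lessThan_Suc)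
  also have "\<dots> = (\<Sum>k<?n. inv_deriv d (?F k) N)"
    by (simp only: additive.sum[OF additive_inv_deriv] sum_fun_apply)
  also have "\<dots> = inv_deriv d (?F 0) N + (\<Sum>k<Suc (mdeg N). inv_deriv d (?F (Suc k)) N)"
    by (rule sum.lessThan_Suc_shift)
  also have "inv_deriv d (?F 0) N = 0"
    by (simp only: F zero scaleQ_0_right)
  also have "(\<Sum>k<Suc (mdeg N). inv_deriv d (?F (Suc k)) N) = (\<Sum>k<Suc (mdeg N). ?c * ?F k N)"
  proof (rule sum.cong)
    fix k
    have "inv_deriv d (?F (Suc k)) N = (1 / fact (Suc k) * of_nat (Suc k)) *\<^sub>Q (?c * mps_power L k N)"
      by (simp only: F power scaleQ_of_nat[symmetric] scaleQ_scaleQ)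
    also have "1 / fact (Suc k) * of_nat (Suc k) = (1 / fact k :: rat)"
      by (simp add: fact_Suc del: of_nat_Suc)
    finally show "inv_deriv d (?F (Suc k)) N = ?c * ?F k N"
      by (simp only: mult_scaleQ_right)
  qed simp
  also have "\<dots> = ?c * mps_exp L N"
    by (simp only: sum_distrib_left[symmetric] mps_exp_truncate[where f = L, OF L0, where N = N and n = "Suc (mdeg N)"] lessI)
  finally show ?thesis by (simp add: weighted_basis_def L_def)
qed

section \<open>Homomorphisms and derivations of integral polynomial rings\<close>

lemma zpoly_induct [case_names one var add neg mult]:
  fixes p :: "'c zpoly"
  assumes one: "P 1" and var: "\<And>c. P (zvar c)" and add: "\<And>p q. P p \<Longrightarrow> P q \<Longrightarrow> P (p + q)"
    and neg: "\<And>p. P p \<Longrightarrow> P (- p)" and mult: "\<And>p q. P p \<Longrightarrow> P q \<Longrightarrow> P (p * q)"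
  shows "P p"
proof -
  have zero: "P 0" using add[OF one neg[OF one]] by simp
  have nat: "P (of_nat n)" for n
    by (induction n) (use zero one add in auto)
  have int: "P (of_int k)" for k
    by (cases k rule: int_cases2) (use nat neg in auto)
  have monom: "P (zmonom zvar m)" for m
  proof -
    have pow: "P (zvar c ^ k)" for c k
      by (induction k) (use one var mult in auto)
    have "P (\<Prod>c\<in>S. zvar c ^ Poly_Mapping.lookup m c)" for S
      by (induction S rule: infinite_finite_induct) (use one pow mult in auto)
    then show ?thesis by (simp add: zmonom_def)
  qed
  have "P (Poly_Mapping.single m k)" for m k
  proof -
    have "of_int k * zmonom zvar m = Poly_Mapping.single m k"
      by (rule poly_mapping_eqI) (simp add: lookup_of_int_mult zmonom_zvar lookup_single when_def)
    then show ?thesis using mult[OF int[of k] monom[of m]] by simp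
  qed
  then have "P (\<Sum>m\<in>S. Poly_Mapping.single m (Poly_Mapping.lookup p m))" for S
    by (induction S rule: infinite_finite_induct) (use zero add in auto)
  then show ?thesis by (metis poly_mapping_sum_single)
qed

lemma of_int_mult_single: "of_int k * Poly_Mapping.single m 1 = (Poly_Mapping.single m k :: 'm::monoid_add \<Rightarrow>\<^sub>0 int)"
  by (rule poly_mapping_eqI) (simp add: lookup_of_int_mult lookup_single when_def)

lemma additive_zpoly_eval: "additive (zpoly_eval \<sigma>)"
  by (simp add: additive_def zpoly_eval_add)

lemma zpoly_eval_of_int: "zpoly_eval \<sigma> (of_int k) = of_int k"
  using additive_of_int[OF additive_zpoly_eval, of \<sigma> k 1] by (simp add: zpoly_eval_1)

lemma zpoly_eval_zpoly_eval:
  "zpoly_eval \<rho> (zpoly_eval \<sigma> p) = zpoly_eval (\<lambda>c. zpoly_eval \<rho> (\<sigma> c)) p"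
  by (induction p rule: zpoly_induct)
    (simp_all add: zpoly_eval_1 zpoly_eval_zvar zpoly_eval_add zpoly_eval_mult
      additive.minus[OF additive_zpoly_eval])

lemma zpoly_eval_ident: "zpoly_eval zvar p = p"
  by (induction p rule: zpoly_induct)
    (simp_all add: zpoly_eval_1 zpoly_eval_zvar zpoly_eval_add zpoly_eval_mult
      additive.minus[OF additive_zpoly_eval])

lemma derivation_unique:
  fixes h \<delta> \<delta>' :: "'c zpoly \<Rightarrow> 's::ring_1"
  assumes add: "additive \<delta>" "additive \<delta>'" and one: "h 1 = 1"
    and prod: "\<And>p q. \<delta> (p * q) = h p * \<delta> q + \<delta> p * h q" "\<And>p q. \<delta>' (p * q) = h p * \<delta>' q + \<delta>' p * h q"
    and var: "\<And>c. \<delta> (zvar c) = \<delta>' (zvar c)"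
  shows "\<delta> p = \<delta>' p"
proof (induction p rule: zpoly_induct)
  case one
  show ?case using prod[of 1 1] by (simp add: assms(3))
qed (simp_all add: var prod additive.add[OF add(1)] additive.add[OF add(2)]
    additive.minus[OF add(1)] additive.minus[OF add(2)])

lemma lookup_zvar: "Poly_Mapping.lookup (zvar c) = (\<lambda>N. if N = unit_monom c then 1 else 0)"
  by (auto simp: zvar_def unit_monom_def lookup_single when_def)

lemma lookup_of_int: "Poly_Mapping.lookup (of_int k) N = (if N = 0 then k else (0::int))"
  using lookup_of_int_mult[of k "1 :: _ \<Rightarrow>\<^sub>0 int" N] by (auto simp: lookup_one when_def)

text \<open>
  Polynomials multiply like power series, so they inherit the Leibniz rule of
  \<open>inv_deriv\<close>.
\<close>

lemma lookup_mult_mps: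
  "Poly_Mapping.lookup (p * q) = mps_mult (Poly_Mapping.lookup p) (Poly_Mapping.lookup q)"
  for p q :: "('c \<Rightarrow>\<^sub>0 nat) \<Rightarrow>\<^sub>0 'r::ring_1"
proof
  fix N
  have "Poly_Mapping.lookup (p * q) N
      = (\<Sum>(K, L). Poly_Mapping.lookup p K * Poly_Mapping.lookup q L when N = K + L)"
    unfolding times_poly_mapping.rep_eq by (rule prod_fun_unfold_prod) simp_all
  also have "\<dots> = (\<Sum>(K, L) | K + L = N. Poly_Mapping.lookup p K * Poly_Mapping.lookup q L when N = K + L)"
    by (rule Sum_any.expand_superset) (auto simp: finite_antidiagonal)
  also have "\<dots> = mps_mult (Poly_Mapping.lookup p) (Poly_Mapping.lookup q) N"
    unfolding mps_mult_def by (intro sum.cong) auto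
  finally show "Poly_Mapping.lookup (p * q) N = mps_mult (Poly_Mapping.lookup p) (Poly_Mapping.lookup q) N" .
qed

section \<open>Invariant derivations of polynomials\<close>

text \<open>
  Translation by the identity element of the centre: the coefficients of \<open>translate
  a\<close> are the Taylor coefficients of the polynomial function \<open>a\<close> at that
  point.
\<close>

definition translate :: "'g::{finite,group_add} class_poly \<Rightarrow> 'g class_poly" where
  "translate = zpoly_eval (\<lambda>c. zvar c + of_int (counit (zvar c)))"

definition untranslate :: "'g::{finite,group_add} class_poly \<Rightarrow> 'g class_poly" where
  "untranslate = zpoly_eval (\<lambda>c. zvar c - of_int (counit (zvar c)))"

lemma additive_translate: "additive translate" "additive untranslate"
  by (simp_all add: translate_def untranslate_def additive_zpoly_eval)

lemma zpoly_eval_diff: "zpoly_eval \<sigma> (p - q) = zpoly_eval \<sigma> p - zpoly_eval \<sigma> q"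
  by (rule additive.diff[OF additive_zpoly_eval])

lemma untranslate_translate: "untranslate (translate p) = p"
  by (simp add: translate_def untranslate_def zpoly_eval_zpoly_eval zpoly_eval_add zpoly_eval_zvar
      zpoly_eval_of_int zpoly_eval_ident)

lemma translate_untranslate: "translate (untranslate p) = p"
  by (simp add: translate_def untranslate_def zpoly_eval_zpoly_eval zpoly_eval_diff zpoly_eval_zvar
      zpoly_eval_of_int zpoly_eval_ident)

lemma translate_mult: "translate (p * q) = translate p * translate q"
  "untranslate (p * q) = untranslate p * untranslate q"
  by (simp_all add: translate_def untranslate_def zpoly_eval_mult)

lemma translate_one: "translate 1 = 1" "untranslate 1 = 1"
  by (simp_all add: translate_def untranslate_def zpoly_eval_1)

lemma counit_eq_lookup_translate: "counit p = Poly_Mapping.lookup (translate p) 0"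
proof (induction p rule: zpoly_induct)
  case (mult p q)
  have "{(K, L). K + L = (0 :: 'a conj_class \<Rightarrow>\<^sub>0 nat)} = {(0, 0)}"
  proof -
    have zero: "K = 0 \<and> L = 0" if "K + L = 0" for K L :: "'a conj_class \<Rightarrow>\<^sub>0 nat"
    proof -
      have "Poly_Mapping.lookup K c = 0 \<and> Poly_Mapping.lookup L c = 0" for c
        using arg_cong[OF that, of "\<lambda>M. Poly_Mapping.lookup M c"] by (simp add: lookup_add)
      then show ?thesis by (auto intro!: poly_mapping_eqI)
    qed
    show ?thesis by (auto dest: zero)
  qed
  then show ?case
    using mult by (simp add: counit_def zpoly_eval_mult translate_mult lookup_mult_mps mps_mult_def)
next
  case (var c)
  show ?case
    by (simp add: translate_def zpoly_eval_zvar lookup_add lookup_of_int lookup_zvar unit_monom_neq_0[symmetric])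
qed (simp_all add: counit_def zpoly_eval_1 translate_one lookup_one zpoly_eval_add
    additive.add[OF additive_translate(1)] additive.minus[OF additive_translate(1)]
    additive.minus[OF additive_zpoly_eval] lookup_add)

definition poly_inv_deriv :: "'g::{finite,group_add} conj_class \<Rightarrow> 'g class_poly \<Rightarrow> 'g class_poly" where
  "poly_inv_deriv d p = Abs_poly_mapping (inv_deriv d (Poly_Mapping.lookup p))"

lemma inv_deriv_vanish:
  assumes "\<And>M. mdeg M \<ge> mdeg N \<Longrightarrow> f M = 0"
  shows "inv_deriv d f N = 0"
proof -
  have "mps_shift e (mps_partial c f) N = mps_shift e (mps_partial c 0) N" for c e
    by (rule mps_shift_partial_cong) (simp add: assms)
  then show ?thesis
    by (simp add: inv_deriv_apply assms additive.zero[OF additive_mps_partial] additive.zero[OF additive_mps_shift])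
qed

lemma lookup_poly_inv_deriv:
  "Poly_Mapping.lookup (poly_inv_deriv d p) = inv_deriv d (Poly_Mapping.lookup p)"
proof -
  define n where "n = Max (insert 0 (mdeg ` Poly_Mapping.keys p))"
  have "inv_deriv d (Poly_Mapping.lookup p) N = 0" if "mdeg N > n" for N
  proof (rule inv_deriv_vanish)
    fix M :: "'a conj_class \<Rightarrow>\<^sub>0 nat" assume "mdeg N \<le> mdeg M"
    then have "mdeg M > n" using that by simp
    then have "M \<notin> Poly_Mapping.keys p" unfolding n_def by auto
    then show "Poly_Mapping.lookup p M = 0" by (simp add: in_keys_iff)
  qed
  then have "{N. inv_deriv d (Poly_Mapping.lookup p) N \<noteq> 0} \<subseteq> {N. mdeg N \<le> n}"
    by (auto simp: not_less[symmetric])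
  then have "finite {N. inv_deriv d (Poly_Mapping.lookup p) N \<noteq> 0}"
    by (rule finite_subset) (rule finite_mdeg_le)
  then show ?thesis unfolding poly_inv_deriv_def by (rule lookup_Abs_poly_mapping)
qed

lemma lookup_plus_fun: "Poly_Mapping.lookup (p + q) = Poly_Mapping.lookup p + Poly_Mapping.lookup q"
  by (simp add: fun_eq_iff lookup_add)

lemma additive_poly_inv_deriv: "additive (poly_inv_deriv d)"
  unfolding additive_def
  by (intro allI poly_mapping_eqI)
    (simp add: lookup_poly_inv_deriv lookup_plus_fun additive.add[OF additive_inv_deriv])

lemma poly_inv_deriv_mult: "poly_inv_deriv d (p * q) = p * poly_inv_deriv d q + poly_inv_deriv d p * q"
  by (rule poly_mapping_eqI)
    (simp add: lookup_poly_inv_deriv lookup_plus_fun lookup_mult_mps inv_deriv_mult)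

text \<open>
  The derivation of the coordinate ring along the vector field of \<open>d\<close>; the
  coordinates of \<open>inv_deriv\<close> are centred at the identity, whence the
  conjugation by \<open>translate\<close>.
\<close>

definition inv_derivation :: "'g::{finite,group_add} conj_class \<Rightarrow> 'g class_poly \<Rightarrow> 'g class_poly" where
  "inv_derivation d a = untranslate (poly_inv_deriv d (translate a))"

lemma additive_inv_derivation: "additive (inv_derivation d)"
  unfolding inv_derivation_def
  by (rule additive_compose[OF additive_translate(2) additive_compose[OF additive_poly_inv_deriv additive_translate(1)]])

lemma inv_derivation_mult: "inv_derivation d (p * q) = p * inv_derivation d q + inv_derivation d p * q"
  by (simp add: inv_derivation_def translate_mult poly_inv_deriv_mult additive.add[OF additive_translate(2)]
      untranslate_translate)

text \<open>
  In the original coordinates the vector field is linear: \<open>t\<^sub>c\<close> becomes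
  the coefficient of \<open>c\<close> in the product of \<open>d\<close> with the generic
  element \<open>\<Sum>e. t\<^sub>e e\<close>.
\<close>

lemma inv_derivation_zvar:
  "inv_derivation d (zvar c) = (\<Sum>e\<in>UNIV. of_int (struct_const d e c) * zvar e)"
proof -
  let ?\<delta> = "if c = d then 1 else 0 :: int"
  have one: "poly_inv_deriv d 1 = 0"
    using poly_inv_deriv_mult[of d 1 1] by simp
  have const: "poly_inv_deriv d (of_int k) = 0" for k
    using additive_of_int[OF additive_poly_inv_deriv, of d k 1] by (simp add: one)
  have lin: "Poly_Mapping.lookup (zvar c) = (\<lambda>N. \<Sum>b\<in>UNIV. if N = unit_monom b then (if b = c then 1 else 0) else 0)"
  proof
    fix N
    have "(\<Sum>b\<in>UNIV. if N = unit_monom b then (if b = c then 1 else 0) else 0 :: int)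
        = (\<Sum>b\<in>UNIV. if b = c then (if N = unit_monom c then 1 else 0) else 0)"
      by (intro sum.cong) auto
    then show "Poly_Mapping.lookup (zvar c) N
        = (\<Sum>b\<in>UNIV. if N = unit_monom b then (if b = c then 1 else 0) else 0)"
      by (simp add: lookup_zvar)
  qed
  have var: "poly_inv_deriv d (zvar c) = of_int ?\<delta> + (\<Sum>e\<in>UNIV. of_int (struct_const d e c) * zvar e)"
  proof (rule poly_mapping_eqI)
    fix N
    show "Poly_Mapping.lookup (poly_inv_deriv d (zvar c)) N
        = Poly_Mapping.lookup (of_int ?\<delta> + (\<Sum>e\<in>UNIV. of_int (struct_const d e c) * zvar e)) N"
      unfolding lookup_poly_inv_deriv inv_deriv_linear[OF lin]
      by (simp add: lookup_add lookup_sum lookup_of_int lookup_of_int_mult lookup_zvar lookup_one if_distrib cong: if_cong)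
  qed
  have "inv_derivation d (zvar c) = untranslate (poly_inv_deriv d (zvar c + of_int (counit (zvar c))))"
    by (simp add: inv_derivation_def translate_def zpoly_eval_zvar)
  also have "\<dots> = untranslate (of_int ?\<delta> + (\<Sum>e\<in>UNIV. of_int (struct_const d e c) * zvar e))"
    by (simp add: additive.add[OF additive_poly_inv_deriv] const var)
  also have "\<dots> = of_int ?\<delta> + (\<Sum>e\<in>UNIV. of_int (struct_const d e c) * (zvar e - of_int (counit (zvar e))))"
    by (simp add: untranslate_def zpoly_eval_add zpoly_eval_sum zpoly_eval_mult zpoly_eval_of_int zpoly_eval_zvar)
  also have "\<dots> = of_int ?\<delta> + (\<Sum>e\<in>UNIV. of_int (struct_const d e c) * zvar e)
      - of_int (\<Sum>e\<in>UNIV. struct_const d e c * counit (zvar e))"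
    by (simp add: right_diff_distrib sum_subtractf)
  also have "(\<Sum>e\<in>UNIV. struct_const d e c * counit (zvar e)) = ?\<delta>"
    by (simp add: counit_def zpoly_eval_zvar if_distrib struct_const_id cong: if_cong)
  finally show ?thesis by simp
qed

text \<open>
  The commutator is a derivation, so it suffices that it kills the variables, and there the
  claim is \<open>d e = e d\<close> together with associativity in the centre.
\<close>

lemma inv_derivation_commute: "inv_derivation d (inv_derivation e a) = inv_derivation e (inv_derivation d a)"
proof -
  let ?D = inv_derivation
  note add = additive.add[OF additive_inv_derivation]
  have "?D d (?D e a) - ?D e (?D d a) = 0"
  proof (rule derivation_unique[where h = "\<lambda>p. p" and \<delta> = "\<lambda>a. ?D d (?D e a) - ?D e (?D d a)" and \<delta>' = "\<lambda>_. 0"])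
    fix c :: "'a conj_class"
    have var: "?D x (?D y (zvar c)) = (\<Sum>q\<in>UNIV. of_int (\<Sum>p\<in>UNIV. struct_const x q p * struct_const y p c) * zvar q)" for x y :: "'a conj_class"
    proof -
      have "?D x (?D y (zvar c)) = (\<Sum>p\<in>UNIV. \<Sum>q\<in>UNIV. of_int (struct_const y p c) * (of_int (struct_const x q p) * zvar q))"
        by (simp add: inv_derivation_zvar additive.sum[OF additive_inv_derivation]
            additive_of_int[OF additive_inv_derivation] sum_distrib_left)
      also have "\<dots> = (\<Sum>q\<in>UNIV. \<Sum>p\<in>UNIV. of_int (struct_const y p c) * (of_int (struct_const x q p) * zvar q))"
        by (rule sum.swap)
      finally show ?thesis by (simp add: sum_distrib_left sum_distrib_right mult_ac)
    qed
    show "?D d (?D e (zvar c)) - ?D e (?D d (zvar c)) = 0"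
      by (simp only: var struct_const_assoc[symmetric] struct_const_commute[of d e]) simp
  qed (simp_all add: additive_def add inv_derivation_mult algebra_simps)
  then show ?thesis by simp
qed

section \<open>Comultiplication and convolution\<close>

lemma additive_tensor: "additive (\<lambda>p. tensor p q)" "additive (\<lambda>q. tensor p q)"
  by (simp_all add: additive_def tensor_add_left tensor_add_right)

lemma tensor_eqI:
  fixes h h' :: "(('m \<times> 'n) \<Rightarrow>\<^sub>0 int) \<Rightarrow> 'z::ab_group_add"
  assumes "additive h" "additive h'" "\<And>p q. h (tensor p q) = h' (tensor p q)"
  shows "h x = h' x"
proof (rule additive_eqI[OF assms(1,2)])
  fix k :: "'m \<times> 'n" and v
  have "Poly_Mapping.single k v = tensor (Poly_Mapping.single (fst k) v) (Poly_Mapping.single (snd k) 1)"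
    by (simp add: tensor_single)
  then show "h (Poly_Mapping.single k v) = h' (Poly_Mapping.single k v)"
    by (simp only: assms(3))
qed

lemma additive_tensor_fun: "additive f \<Longrightarrow> additive (tensor_fun f g)"
  unfolding tensor_fun_def by (rule tensor_lift_additive) (simp add: additive_def algebra_simps)

type_synonym 'g class_poly_square = "(('g conj_class \<Rightarrow>\<^sub>0 nat) \<times> ('g conj_class \<Rightarrow>\<^sub>0 nat)) \<Rightarrow>\<^sub>0 int"

text \<open>
  The operator \<open>inv_derivation d \<otimes> 1\<close> on the tensor square.
\<close>

definition left_derivation ::
    "'g::{finite,group_add} conj_class \<Rightarrow> 'g class_poly_square \<Rightarrow> 'g class_poly_square" where
  "left_derivation d = tensor_lift (\<lambda>p q. tensor (inv_derivation d p) q)"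

lemma additive_left_derivation: "additive (left_derivation d)"
  unfolding left_derivation_def
  by (rule tensor_lift_additive) (intro additive_compose[OF additive_tensor(1)] additive_inv_derivation)

lemma left_derivation_tensor: "left_derivation d (tensor p q) = tensor (inv_derivation d p) q"
  unfolding left_derivation_def
  by (rule tensor_lift_tensor)
    (intro additive_compose[OF additive_tensor(1)] additive_inv_derivation additive_tensor(2))+

lemma left_derivation_mult:
  "left_derivation d (x * y) = x * left_derivation d y + left_derivation d x * y"
proof -
  note add = additive.add[OF additive_left_derivation]
  have l: "additive (\<lambda>x. left_derivation d (x * y))"
      "additive (\<lambda>x. x * left_derivation d y + left_derivation d x * y)"
    and r: "additive (\<lambda>y. left_derivation d (x * y))"
      "additive (\<lambda>y. x * left_derivation d y + left_derivation d x * y)" for x y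
    by (simp_all add: additive_def add algebra_simps)
  show ?thesis
    by (rule tensor_eqI[OF l], rule tensor_eqI[OF r])
      (simp add: tensor_mult left_derivation_tensor inv_derivation_mult tensor_add_left)
qed

lemma sum_rotate:
  "(\<Sum>a\<in>A. \<Sum>b\<in>B. \<Sum>c\<in>C. \<phi> a b c) = (\<Sum>b\<in>B. \<Sum>c\<in>C. \<Sum>a\<in>A. \<phi> a b c :: 'r::comm_monoid_add)"
proof -
  have "(\<Sum>a\<in>A. \<Sum>b\<in>B. \<Sum>c\<in>C. \<phi> a b c) = (\<Sum>b\<in>B. \<Sum>a\<in>A. \<Sum>c\<in>C. \<phi> a b c)"
    by (rule sum.swap)
  also have "\<dots> = (\<Sum>b\<in>B. \<Sum>c\<in>C. \<Sum>a\<in>A. \<phi> a b c)"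
    by (intro sum.cong refl) (rule sum.swap)
  finally show ?thesis .
qed

text \<open>
  This is the invariance of the vector field, \<open>d (y z) = (d y) z\<close>: on variables
  it is the associativity of the structure constants, and both sides are derivations along
  the comultiplication.
\<close>

lemma comult_inv_derivation: "comult (inv_derivation d a) = left_derivation d (comult a)"
proof (rule derivation_unique[where h = comult])
  show "additive (\<lambda>a. comult (inv_derivation d a))" "additive (\<lambda>a. left_derivation d (comult a))"
    unfolding comult_def
    by (rule additive_compose[OF additive_zpoly_eval additive_inv_derivation]
        additive_compose[OF additive_left_derivation additive_zpoly_eval])+
next
  fix c :: "'a conj_class"
  let ?A = "struct_const :: 'a conj_class \<Rightarrow> _"
  have comult_zvar: "comult (zvar c) = (\<Sum>r\<in>UNIV. \<Sum>q\<in>UNIV. of_int (?A r q c) * tensor (zvar r) (zvar q))" for c :: "'a conj_class"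
    by (simp add: comult_def zpoly_eval_zvar)
  have "comult (inv_derivation d (zvar c))
      = (\<Sum>e\<in>UNIV. \<Sum>r\<in>UNIV. \<Sum>q\<in>UNIV. of_int (?A d e c) * (of_int (?A r q e) * tensor (zvar r) (zvar q)))"
    unfolding inv_derivation_zvar comult_def
    by (simp add: zpoly_eval_sum zpoly_eval_mult zpoly_eval_of_int comult_zvar[unfolded comult_def] sum_distrib_left)
  also have "\<dots> = (\<Sum>r\<in>UNIV. \<Sum>q\<in>UNIV. \<Sum>e\<in>UNIV. of_int (?A d e c) * (of_int (?A r q e) * tensor (zvar r) (zvar q)))"
    by (rule sum_rotate)
  also have "\<dots> = (\<Sum>r\<in>UNIV. \<Sum>q\<in>UNIV. of_int (\<Sum>e\<in>UNIV. ?A r q e * ?A d e c) * tensor (zvar r) (zvar q))"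
    by (simp add: sum_distrib_left sum_distrib_right mult_ac)
  also have "\<dots> = (\<Sum>r\<in>UNIV. \<Sum>q\<in>UNIV. of_int (\<Sum>p\<in>UNIV. ?A d r p * ?A p q c) * tensor (zvar r) (zvar q))"
    by (simp only: struct_const_assoc)
  also have "\<dots> = (\<Sum>r\<in>UNIV. \<Sum>q\<in>UNIV. \<Sum>p\<in>UNIV. of_int (?A p q c) * (of_int (?A d r p) * tensor (zvar r) (zvar q)))"
    by (simp add: sum_distrib_left sum_distrib_right mult_ac)
  also have "\<dots> = (\<Sum>p\<in>UNIV. \<Sum>q\<in>UNIV. \<Sum>r\<in>UNIV. of_int (?A p q c) * (of_int (?A d r p) * tensor (zvar r) (zvar q)))"
    by (subst sum_rotate[symmetric]) (rule sum.cong[OF refl], rule sum.swap)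
  also have "\<dots> = left_derivation d (comult (zvar c))"
    by (simp add: comult_zvar additive.sum[OF additive_left_derivation] additive_of_int[OF additive_left_derivation]
        left_derivation_tensor inv_derivation_zvar additive.sum[OF additive_tensor(1)]
        additive_of_int[OF additive_tensor(1)] sum_distrib_left)
  finally show "comult (inv_derivation d (zvar c)) = left_derivation d (comult (zvar c))" .
qed (simp_all add: comult_def zpoly_eval_1 inv_derivation_mult zpoly_eval_add zpoly_eval_mult left_derivation_mult)

text \<open>
  The product of the distribution algebra, here for arbitrary functionals.
\<close>

definition convolution ::
    "('g::{finite,group_add} class_poly \<Rightarrow> int) \<Rightarrow> ('g class_poly \<Rightarrow> int) \<Rightarrow> 'g class_poly \<Rightarrow> int" where
  "convolution f g a = tensor_fun f g (comult a)"

lemma convolution_inv_derivation: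
  assumes f: "additive f" and g: "additive g"
  shows "convolution (\<lambda>a. f (inv_derivation d a)) g = (\<lambda>a. convolution f g (inv_derivation d a))"
proof
  fix a
  have f': "additive (\<lambda>a. f (inv_derivation d a))"
    by (rule additive_compose[OF f additive_inv_derivation])
  have "tensor_fun (\<lambda>a. f (inv_derivation d a)) g x = tensor_fun f g (left_derivation d x)" for x
    by (rule tensor_eqI)
      (simp_all add: additive_tensor_fun f f' additive_compose[OF additive_tensor_fun[OF f] additive_left_derivation]
        tensor_fun_tensor g left_derivation_tensor)
  then show "convolution (\<lambda>a. f (inv_derivation d a)) g a = convolution f g (inv_derivation d a)"
    by (simp add: convolution_def comult_inv_derivation)
qed

lemma additive_counit: "additive counit"
  by (simp add: counit_def additive_zpoly_eval)

text \<open>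
  The map \<open>E\<close> in the proof is the counit on the first tensor factor; composed
  with the comultiplication it is the identity, because \<open>class_id\<close> is a unit
  for the product of classes.
\<close>

lemma convolution_counit:
  assumes g: "additive g"
  shows "convolution counit g = g"
proof
  fix a
  define E :: "'a class_poly_square \<Rightarrow> 'a class_poly" where "E = tensor_lift (\<lambda>p q. of_int (counit p) * q)"
  have E_add: "additive E"
    unfolding E_def by (rule tensor_lift_additive) (simp add: additive_def additive.add[OF additive_counit] algebra_simps)
  have E: "E (tensor p q) = of_int (counit p) * q" for p q
    unfolding E_def
    by (rule tensor_lift_tensor) (simp_all add: additive_def additive.add[OF additive_counit] algebra_simps)
  have E_mult: "E (x * y) = E x * E y" for x y
  proof -
    have l: "additive (\<lambda>x. E (x * y))" "additive (\<lambda>x. E x * E y)"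
      and r: "additive (\<lambda>y. E (x * y))" "additive (\<lambda>y. E x * E y)" for x y
      by (simp_all add: additive_def additive.add[OF E_add] algebra_simps)
    show ?thesis
      by (rule tensor_eqI[OF l], rule tensor_eqI[OF r])
        (simp add: tensor_mult E counit_def zpoly_eval_mult mult_ac)
  qed
  have E_comult: "E (comult a) = a" for a
  proof (induction a rule: zpoly_induct)
    case one
    have "1 = tensor (1 :: 'a class_poly) (1 :: 'a class_poly)"
      using tensor_single[of 0 1 0 1] by (simp add: zero_prod_def[symmetric])
    then have "E 1 = 1" using E[of 1 1] by (simp add: counit_def zpoly_eval_1)
    then show ?case by (simp add: comult_def zpoly_eval_1)
  next
    case (var c)
    have id: "struct_const class_id e c = (if c = e then 1 else 0)" for e
      by (simp add: struct_const_commute[of class_id] struct_const_id)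
    have "E (comult (zvar c)) = (\<Sum>d\<in>UNIV. \<Sum>e\<in>UNIV. of_int (struct_const d e c) * (of_int (counit (zvar d)) * zvar e))"
      by (simp add: comult_def zpoly_eval_zvar additive.sum[OF E_add] additive_of_int[OF E_add] E)
    also have "\<dots> = (\<Sum>d\<in>UNIV. if d = (class_id :: 'a conj_class) then
        (\<Sum>e\<in>UNIV. of_int (if c = e then 1 else 0) * zvar e) else 0)"
      by (intro sum.cong refl) (auto simp: counit_def zpoly_eval_zvar id)
    also have "(\<Sum>e\<in>UNIV. of_int (if c = e then 1 else 0) * zvar e) = (\<Sum>e\<in>UNIV. if e = c then zvar e else 0)"
      by (intro sum.cong) auto
    finally show ?case by simp
  qed (simp_all add: comult_def zpoly_eval_add zpoly_eval_mult E_mult additive.add[OF E_add]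
      additive.minus[OF additive_zpoly_eval] additive.minus[OF E_add])
  have "tensor_fun counit g x = g (E x)" for x
  proof (rule tensor_eqI)
    show "additive (tensor_fun counit g)" by (rule additive_tensor_fun[OF additive_counit])
    show "additive (\<lambda>x. g (E x))" by (rule additive_compose[OF g E_add])
    show "tensor_fun counit g (tensor p q) = g (E (tensor p q))" for p q
      by (simp add: tensor_fun_tensor additive_counit g E additive_of_int[OF g])
  qed
  then show "convolution counit g a = g a"
    by (simp add: convolution_def E_comult)
qed

section \<open>Integral combinations\<close>

definition lincomb :: "('m \<Rightarrow> 'r::ring_1) \<Rightarrow> ('m \<Rightarrow>\<^sub>0 int) \<Rightarrow> 'r" where
  "lincomb b F = (\<Sum>m\<in>Poly_Mapping.keys F. of_int (Poly_Mapping.lookup F m) * b m)"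

lemma additive_lincomb: "additive (lincomb b)"
  unfolding additive_def lincomb_def
  by (intro allI setsum_keys_plus_distrib) (simp_all add: algebra_simps)

lemma lincomb_single: "lincomb b (Poly_Mapping.single m k) = of_int k * b m"
  by (simp add: lincomb_def)

lemma additive_comp_lincomb: "additive h \<Longrightarrow> h (lincomb b F) = lincomb (\<lambda>m. h (b m)) F"
  by (simp add: lincomb_def additive.sum additive_of_int)

lemma lincomb_unit: "lincomb (\<lambda>m. Poly_Mapping.single m 1) F = (F :: 'm::monoid_add \<Rightarrow>\<^sub>0 int)"
  by (simp add: lincomb_def of_int_mult_single poly_mapping_sum_single[symmetric])

lemma lincomb_apply: "lincomb b F x = lincomb (\<lambda>m. b m x) F"
  by (simp add: lincomb_def sum_fun_apply of_int_fun_apply)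

section \<open>Functionals with finitely many Taylor coefficients\<close>

text \<open>
  Up to factorials these are the higher partial derivatives at the identity of the centre.
  They form the basis of the distribution algebra that corresponds to
  \<open>weighted_basis\<close>.
\<close>

definition coord_fun :: "('g::{finite,group_add} conj_class, 'g class_poly \<Rightarrow> int) mps" where
  "coord_fun N a = Poly_Mapping.lookup (translate a) N"

abbreviation shifted_monom :: "('g::{finite,group_add} conj_class \<Rightarrow>\<^sub>0 nat) \<Rightarrow> 'g class_poly" where
  "shifted_monom N \<equiv> untranslate (Poly_Mapping.single N 1)"

lemma additive_apply: "additive (\<lambda>f. f a)"
  by (simp add: additive_def)

lemma additive_precomp: "additive (\<lambda>f. (\<lambda>a. f (h a)))"
  by (simp add: additive_def plus_fun_def)

text \<open>
  The recursion for the functionals \<open>coord_fun\<close>, parallel to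
  \<open>inv_deriv_weighted_basis\<close>.
\<close>

lemma inv_deriv_coord_fun: "inv_deriv d coord_fun N = (\<lambda>a. coord_fun N (inv_derivation d a))"
proof
  fix a
  have "inv_deriv d coord_fun N a = inv_deriv d (\<lambda>N. coord_fun N a) N"
    by (rule additive_inv_deriv_comp[OF additive_apply])
  also have "\<dots> = coord_fun N (inv_derivation d a)"
    by (simp add: coord_fun_def[abs_def] inv_derivation_def translate_untranslate lookup_poly_inv_deriv)
  finally show "inv_deriv d coord_fun N a = coord_fun N (inv_derivation d a)" .
qed

lemma coord_fun_0: "coord_fun 0 = counit"
  by (simp add: fun_eq_iff coord_fun_def counit_eq_lookup_translate)

definition functional :: "'g::{finite,group_add} class_poly \<Rightarrow> 'g class_poly \<Rightarrow> int" where
  "functional = lincomb coord_fun"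

lemma additive_functional: "additive functional"
  unfolding functional_def by (rule additive_lincomb)

lemma functional_apply: "functional F a = lincomb (\<lambda>N. coord_fun N a) F"
  by (simp add: functional_def lincomb_apply)

lemma functional_single: "functional (Poly_Mapping.single N 1) = coord_fun N"
  by (simp add: functional_def lincomb_single)

lemma coord_fun_shifted_monom: "coord_fun M (shifted_monom N) = (if M = N then 1 else 0)"
  by (auto simp: coord_fun_def translate_untranslate lookup_single when_def)

lemma functional_shifted_monom: "functional F (shifted_monom N) = Poly_Mapping.lookup F N"
proof -
  have "functional F (shifted_monom N)
      = (\<Sum>m\<in>Poly_Mapping.keys F. if m = N then Poly_Mapping.lookup F m else 0)"
    unfolding functional_apply lincomb_def by (intro sum.cong) (auto simp: coord_fun_shifted_monom)
  then show ?thesis by (simp add: in_keys_iff)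
qed

lemma inj_functional: "inj functional"
  by (rule injI, rule poly_mapping_eqI) (metis functional_shifted_monom)

lemma additive_functional_apply: "additive (functional F)"
proof -
  have "functional F a = (\<Sum>N\<in>Poly_Mapping.keys F. Poly_Mapping.lookup F N * Poly_Mapping.lookup (translate a) N)" for a
    by (simp add: functional_apply lincomb_def coord_fun_def)
  then show ?thesis
    by (simp add: additive_def additive.add[OF additive_translate(1)] lookup_add algebra_simps sum.distrib)
qed

text \<open>
  Every polynomial is an integral combination of the \<open>shifted_monom N\<close>, on
  which the functionals \<open>coord_fun N\<close> are the dual family.
\<close>

lemma additive_functional_expand:
  assumes "additive f" and "\<And>N. f (shifted_monom N) = Poly_Mapping.lookup F N"
  shows "f = functional F"
proof
  fix a
  have add: "additive (\<lambda>p. f (untranslate p))" "additive (\<lambda>p. functional F (untranslate p))"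
    by (rule additive_compose[OF assms(1) additive_translate(2)]
        additive_compose[OF additive_functional_apply additive_translate(2)])+
  have "f (untranslate p) = functional F (untranslate p)" for p
  proof -
    have "f (untranslate (lincomb (\<lambda>m. Poly_Mapping.single m 1) p))
        = functional F (untranslate (lincomb (\<lambda>m. Poly_Mapping.single m 1) p))"
      by (simp only: additive_comp_lincomb[OF add(1)] additive_comp_lincomb[OF add(2)]
          assms(2) functional_shifted_monom)
    then show ?thesis by (simp only: lincomb_unit)
  qed
  from this[of "translate a"] show "f a = functional F a" by (simp add: untranslate_translate)
qed

lemma range_functional_iff:
  "f \<in> range functional \<longleftrightarrow> additive f \<and> finite {N. f (shifted_monom N) \<noteq> 0}"
proof
  assume "f \<in> range functional"
  then obtain F where "f = functional F" by auto
  then show "additive f \<and> finite {N. f (shifted_monom N) \<noteq> 0}"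
    by (simp add: additive_functional_apply functional_shifted_monom)
next
  assume f: "additive f \<and> finite {N. f (shifted_monom N) \<noteq> 0}"
  then have "f = functional (Abs_poly_mapping (\<lambda>N. f (shifted_monom N)))"
    by (intro additive_functional_expand) (simp_all add: lookup_Abs_poly_mapping)
  then show "f \<in> range functional" by blast
qed

section \<open>Functionals vanishing on a power of the augmentation ideal\<close>

lemma shifted_monom_in_ideal_power:
  "shifted_monom N \<in> ideal_power ring_of_type_algebra aug_ideal (mdeg N)"
proof (induction N rule: monom_induct)
  case zero
  show ?case by simp
next
  case (step N c)
  have "Poly_Mapping.single (N + unit_monom c) 1 = Poly_Mapping.single N 1 * (zvar c :: 'a class_poly)"
    by (simp add: zvar_def unit_monom_def mult_single)
  then have "shifted_monom (N + unit_monom c) = shifted_monom N * (zvar c - of_int (counit (zvar c)))"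
    by (simp add: translate_mult) (simp add: untranslate_def zpoly_eval_zvar)
  moreover have "shifted_monom N * (zvar c - of_int (counit (zvar c)))
      \<in> ideal_power ring_of_type_algebra aug_ideal (Suc (mdeg N))"
    using ideal_prod.prod[OF step[OF order_refl] aug_ideal_gens[of c], of ring_of_type_algebra] by simp
  ultimately show ?case by simp
qed

text \<open>
  The order of vanishing at the identity is additive on products, and it is positive on the
  ideal because the counit is the value at the identity.
\<close>

lemma coord_fun_ideal_power:
  assumes "a \<in> ideal_power ring_of_type_algebra aug_ideal n" "mdeg N < n"
  shows "coord_fun N a = 0"
  using assms
proof (induction n arbitrary: a N)
  case (Suc n)
  from Suc.prems(1) have "a \<in> ideal_prod ring_of_type_algebra (ideal_power ring_of_type_algebra aug_ideal n) aug_ideal"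
    by simp
  then show ?case using Suc.prems(2)
  proof (induction a arbitrary: N rule: ideal_prod.induct)
    case (prod i j)
    have "Poly_Mapping.lookup (translate i) K * Poly_Mapping.lookup (translate j) L = 0" if "K + L = N" for K L
    proof (cases "mdeg K < n")
      case True
      then show ?thesis using Suc.IH[OF prod(1)] by (simp add: coord_fun_def)
    next
      case False
      then have "mdeg L = 0" using prod.prems mdeg_add[of K L] that by simp
      then have "L = 0" by (auto simp: mdeg_def intro!: poly_mapping_eqI)
      then show ?thesis using counit_aug_ideal[OF prod(2)] by (simp add: counit_eq_lookup_translate)
    qed
    then show ?case
      by (auto simp: coord_fun_def translate_mult lookup_mult_mps mps_mult_def intro!: sum.neutral)
  next
    case (sum s1 s2)
    then show ?case by (simp add: coord_fun_def additive.add[OF additive_translate(1)] lookup_add)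
  qed
qed simp

lemma ideal_power_Suc_subset:
  "ideal_power ring_of_type_algebra aug_ideal (Suc n) \<subseteq> ideal_power (ring_of_type_algebra :: 'g::{finite,group_add} class_poly ring) aug_ideal n"
proof -
  let ?R = "ring_of_type_algebra :: 'g class_poly ring"
  interpret ring ?R by (rule ring_ring_of_type_algebra)
  have ideal: "ideal (ideal_power ?R aug_ideal n) ?R" for n
    by (induction n) (use oneideal aug_ideal in \<open>auto intro: ideal_prod_is_ideal\<close>)
  show ?thesis
    using ideal_prod_inter[OF ideal[of n] aug_ideal] by simp
qed

text \<open>
  A functional that vanishes on the \<open>n\<close>-th power of the ideal kills every
  \<open>shifted_monom N\<close> of degree at least \<open>n\<close>, so only finitely many
  of its Taylor coefficients are nonzero. Conversely, \<open>coord_fun N\<close> kills all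
  powers of the ideal beyond the degree of \<open>N\<close>.
\<close>

lemma carrier_distribution_algebra: "carrier distribution_algebra = range functional"
proof (intro Set.set_eqI iffI)
  fix f :: "'a class_poly \<Rightarrow> int"
  let ?I = "ideal_power ring_of_type_algebra aug_ideal"
  assume "f \<in> carrier distribution_algebra"
  then obtain n where f: "additive f" "\<And>a. a \<in> ?I n \<Longrightarrow> f a = 0"
    by (auto simp: distribution_algebra_def)
  have mono: "?I m \<subseteq> ?I n" if "n \<le> m" for m
    using that by (rule lift_Suc_antimono_le[of ?I, OF ideal_power_Suc_subset])
  have "{N. f (shifted_monom N) \<noteq> 0} \<subseteq> {N. mdeg N \<le> n}"
  proof
    fix N assume "N \<in> {N. f (shifted_monom N) \<noteq> 0}"
    then have "shifted_monom N \<notin> ?I n" using f(2) by auto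
    then have "\<not> n \<le> mdeg N" using mono shifted_monom_in_ideal_power[of N] by blast
    then show "N \<in> {N. mdeg N \<le> n}" by simp
  qed
  then have "finite {N. f (shifted_monom N) \<noteq> 0}"
    by (rule finite_subset) (rule finite_mdeg_le)
  then show "f \<in> range functional" using f(1) by (simp add: range_functional_iff)
next
  fix f :: "'a class_poly \<Rightarrow> int"
  assume "f \<in> range functional"
  then obtain F where f: "f = functional F" by auto
  define n where "n = Suc (Max (insert 0 (mdeg ` Poly_Mapping.keys F)))"
  have deg: "mdeg N < n" if "N \<in> Poly_Mapping.keys F" for N
    unfolding n_def using that by (auto simp: less_Suc_eq_le)
  have "functional F a = 0" if "a \<in> ideal_power ring_of_type_algebra aug_ideal n" for a
    using coord_fun_ideal_power[OF that deg] by (simp add: functional_apply lincomb_def)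
  then show "f \<in> carrier distribution_algebra"
    unfolding f distribution_algebra_def using additive_functional_apply[of F] by auto
qed

section \<open>Convolution and weighted combinations\<close>

lemma additive_convolution: "additive f \<Longrightarrow> additive (convolution f g)"
  unfolding convolution_def comult_def
  by (rule additive_compose[OF additive_tensor_fun additive_zpoly_eval])

lemma additive_convolution_left: "additive (\<lambda>f. convolution f g)"
  by (simp add: additive_def convolution_def tensor_fun_def tensor_lift_def fun_eq_iff
      split_def algebra_simps sum.distrib)

text \<open>
  The effect of composing a functional with \<open>inv_derivation d\<close>, expressed on
  its Taylor coefficients. The elements of the polynomial type serve here as finitely
  supported integer families.
\<close>

definition inv_deriv_comb :: "'g::{finite,group_add} conj_class \<Rightarrow> 'g class_poly \<Rightarrow> 'g class_poly" where
  "inv_deriv_comb d = lincomb (inv_deriv d (\<lambda>N. Poly_Mapping.single N 1))"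

lemma functional_inv_deriv_comb:
  "functional (inv_deriv_comb d F) = (\<lambda>a. functional F (inv_derivation d a))"
proof -
  have "functional (inv_deriv_comb d F) = lincomb (\<lambda>N. (\<lambda>a. coord_fun N (inv_derivation d a))) F"
    by (simp add: inv_deriv_comb_def additive_comp_lincomb[OF additive_functional]
        additive_inv_deriv_comp[OF additive_functional] functional_single inv_deriv_coord_fun)
  also have "\<dots> = (\<lambda>a. lincomb coord_fun F (inv_derivation d a))"
    by (rule additive_comp_lincomb[OF additive_precomp, symmetric])
  finally show ?thesis by (simp only: functional_def)
qed

lemma range_functional_add: "f \<in> range functional \<Longrightarrow> g \<in> range functional \<Longrightarrow> f + g \<in> range functional"
  by (metis (no_types) additive.add[OF additive_functional] rangeE rangeI)

lemma range_functional_zero: "0 \<in> range functional"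
  by (metis additive.zero[OF additive_functional] rangeI)

lemma range_functional_of_int: "f \<in> range functional \<Longrightarrow> of_int k * f \<in> range functional"
  by (metis (no_types) additive_of_int[OF additive_functional] rangeE rangeI)

lemma range_functional_sum: "(\<And>i. i \<in> S \<Longrightarrow> f i \<in> range functional) \<Longrightarrow> (\<Sum>i\<in>S. f i) \<in> range functional"
  by (induction S rule: infinite_finite_induct)
    (simp_all add: range_functional_zero range_functional_add)

lemma inv_deriv_convolution_coord_fun:
  assumes "additive g"
  shows "inv_deriv d (\<lambda>N. convolution (coord_fun N) g) N
    = (\<lambda>a. convolution (coord_fun N) g (inv_derivation d a))"
proof -
  have "additive (coord_fun N)"
    using additive_functional_apply[of "Poly_Mapping.single N 1"] by (simp add: functional_single)
  then show ?thesis
    by (simp add: additive_inv_deriv_comp[OF additive_convolution_left, symmetric]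
      inv_deriv_coord_fun convolution_inv_derivation assms)
qed

text \<open>
  By the recursion, a positive multiple of the value at \<open>N + unit_monom d\<close> is a
  combination of values in the degree of \<open>N\<close> and of a composite with
  \<open>inv_derivation d\<close>, all of which have finitely many nonzero Taylor
  coefficients. Dividing by the multiple does not enlarge the support.
\<close>

lemma convolution_coord_fun_in_range:
  assumes g: "g \<in> range functional"
  shows "convolution (coord_fun N) g \<in> range functional"
proof (induction N rule: monom_induct)
  case zero
  show ?case using g by (simp add: coord_fun_0 convolution_counit range_functional_iff)
next
  case (step N d)
  let ?E = "\<lambda>N. convolution (coord_fun N) g"
  have add: "additive g" using g by (simp add: range_functional_iff)
  have "?E N \<in> range functional" by (rule step) simp
  then obtain H where H: "?E N = functional H" by auto
  have "inv_deriv d ?E N = functional (inv_deriv_comb d H)"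
    by (simp only: inv_deriv_convolution_coord_fun[OF add] H functional_inv_deriv_comb)
  moreover define rest where "rest = (\<Sum>c\<in>UNIV. \<Sum>e\<in>UNIV. of_int (struct_const d e c) * mps_shift e (mps_partial c ?E) N)"
  ultimately have eq: "of_int (int (Suc (Poly_Mapping.lookup N d))) * ?E (N + unit_monom d)
      = functional (inv_deriv_comb d H) + of_int (- 1) * rest"
    by (simp add: inv_deriv_apply algebra_simps)
  have "mps_shift e (mps_partial c ?E) N \<in> range functional" for c e
  proof (cases "Poly_Mapping.lookup N e > 0")
    case True
    have "?E (N - unit_monom e + unit_monom c) \<in> range functional"
      using mdeg_minus_unit[OF True] by (intro step) simp
    then show ?thesis
      using True range_functional_of_int[of _ "int _"]
      by (simp only: mps_shift_def mps_partial_def if_True of_int_of_nat_eq)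
  qed (simp add: mps_shift_def range_functional_zero)
  then have "rest \<in> range functional"
    unfolding rest_def by (intro range_functional_sum range_functional_of_int)
  then have "of_int (int (Suc (Poly_Mapping.lookup N d))) * ?E (N + unit_monom d) \<in> range functional"
    unfolding eq by (intro range_functional_add range_functional_of_int rangeI)
  then have "finite {M. ?E (N + unit_monom d) (shifted_monom M) \<noteq> 0}"
    by (simp add: range_functional_iff of_int_fun_apply)
  moreover have "additive (?E (N + unit_monom d))"
    using additive_functional_apply[of "Poly_Mapping.single (N + unit_monom d) 1"]
    by (simp add: functional_single additive_convolution)
  ultimately show ?case by (simp add: range_functional_iff)
qed

text \<open>
  Linear extension of \<open>coord_fun N \<mapsto> weighted_basis N\<close>, from the Taylor
  coefficients of a distribution to the enveloping algebra.
\<close>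

definition weighted_comb :: "'g::{finite,group_add} class_poly \<Rightarrow> 'g rat_centre enveloping" where
  "weighted_comb = lincomb weighted_basis"

lemma additive_weighted_comb: "additive weighted_comb"
  unfolding weighted_comb_def by (rule additive_lincomb)

lemma weighted_comb_single: "weighted_comb (Poly_Mapping.single N 1) = weighted_basis N"
  by (simp add: weighted_comb_def lincomb_single)

lemma weighted_comb_inv_deriv_comb:
  "weighted_comb (inv_deriv_comb d F) = env_incl (centre_class d) * weighted_comb F"
proof -
  have left: "additive (\<lambda>u. env_incl (centre_class d) * u)"
    by (simp add: additive_def algebra_simps)
  show ?thesis
    by (simp add: inv_deriv_comb_def additive_comp_lincomb[OF additive_weighted_comb]
        additive_inv_deriv_comp[OF additive_weighted_comb] weighted_comb_single inv_deriv_weighted_basis)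
      (simp add: weighted_comb_def additive_comp_lincomb[OF left])
qed

text \<open>
  For fixed \<open>G\<close> let \<open>H N\<close> be the coefficients of \<open>coord_fun
  N\<close> convolved with \<open>functional G\<close>. Convolution commutes with
  \<open>inv_derivation\<close> in its left argument, so \<open>weighted_comb (H N)\<close>
  and \<open>weighted_basis N * weighted_comb G\<close> satisfy the same recursion with the
  same initial value.
\<close>

lemma weighted_comb_convolution:
  "\<exists>H. functional H = convolution (functional F) (functional G) \<and> weighted_comb H = weighted_comb F * weighted_comb G"
proof -
  let ?E = "\<lambda>N. convolution (coord_fun N) (functional G)"
  have "\<forall>N. \<exists>H. ?E N = functional H"
    using convolution_coord_fun_in_range[OF rangeI] by (metis rangeE)
  then obtain H where H: "\<And>N. ?E N = functional (H N)" by metis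
  have rec: "inv_deriv d H N = inv_deriv_comb d (H N)" for d N
  proof (rule injD[OF inj_functional])
    have "functional (inv_deriv d H N) = inv_deriv d ?E N"
      by (simp only: additive_inv_deriv_comp[OF additive_functional] H)
    also have "\<dots> = (\<lambda>a. ?E N (inv_derivation d a))"
      by (rule inv_deriv_convolution_coord_fun[OF additive_functional_apply])
    also have "\<dots> = functional (inv_deriv_comb d (H N))"
      by (simp only: H functional_inv_deriv_comb)
    finally show "functional (inv_deriv d H N) = functional (inv_deriv_comb d (H N))" .
  qed
  have right: "additive (\<lambda>u. u * weighted_comb G)"
    by (simp add: additive_def algebra_simps)
  have basis: "weighted_comb (H N) = weighted_basis N * weighted_comb G" for N
  proof (rule inv_deriv_unique[where p = "\<lambda>d u. env_incl (centre_class d) * u"])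
    show "inv_deriv d (\<lambda>N. weighted_comb (H N)) N = env_incl (centre_class d) * weighted_comb (H N)" for d N
      by (simp only: additive_inv_deriv_comp[OF additive_weighted_comb, symmetric] rec weighted_comb_inv_deriv_comb)
    show "inv_deriv d (\<lambda>N. weighted_basis N * weighted_comb G) N
        = env_incl (centre_class d) * (weighted_basis N * weighted_comb G)" for d N
      by (simp only: additive_inv_deriv_comp[OF right, symmetric] inv_deriv_weighted_basis mult.assoc)
    have "H 0 = G"
      by (rule injD[OF inj_functional])
        (simp only: H[symmetric] coord_fun_0 convolution_counit[OF additive_functional_apply])
    then show "weighted_comb (H 0) = weighted_basis 0 * weighted_comb G"
      by (simp add: weighted_basis_0)
  qed (rule rat_algebra_torsion_free)
  have F: "functional F = lincomb coord_fun F"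
    by (simp only: functional_def)
  have "convolution (functional F) (functional G) = lincomb ?E F"
    unfolding F by (rule additive_comp_lincomb[OF additive_convolution_left])
  also have "\<dots> = functional (lincomb H F)"
    by (simp only: H additive_comp_lincomb[OF additive_functional])
  finally have "functional (lincomb H F) = convolution (functional F) (functional G)" by simp
  moreover have "weighted_comb (lincomb H F) = weighted_comb F * weighted_comb G"
  proof -
    have "weighted_comb (lincomb H F) = lincomb (\<lambda>N. weighted_basis N * weighted_comb G) F"
      by (simp only: additive_comp_lincomb[OF additive_weighted_comb] basis)
    also have "\<dots> = lincomb weighted_basis F * weighted_comb G"
      by (rule additive_comp_lincomb[OF right, symmetric])
    finally show ?thesis by (simp only: weighted_comb_def)
  qed
  ultimately show ?thesis by blast
qed

section \<open>Linear independence of the weighted basis\<close>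

lemma ideal_type_algebraI:
  assumes "0 \<in> S" "\<And>x y. x \<in> S \<Longrightarrow> y \<in> S \<Longrightarrow> x + y \<in> S"
    and "\<And>x y. x \<in> S \<Longrightarrow> y * x \<in> S" "\<And>x y. x \<in> S \<Longrightarrow> x * y \<in> S"
  shows "ideal S (ring_of_type_algebra :: 'r::ring_1 ring)"
proof (rule idealI[OF ring_ring_of_type_algebra])
  interpret ring "ring_of_type_algebra :: 'r ring"
    by (rule ring_ring_of_type_algebra)
  show "subgroup S (add_monoid (ring_of_type_algebra :: 'r ring))"
  proof (rule group.subgroupI)
    show "group (add_monoid (ring_of_type_algebra :: 'r ring))"
      by (rule add.is_group)
  next
    fix a assume a: "a \<in> S"
    have "(\<ominus>\<^bsub>ring_of_type_algebra\<^esub> a) = - a"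
      by (rule minus_equality) simp_all
    then show "inv\<^bsub>add_monoid ring_of_type_algebra\<^esub> a \<in> S"
      using assms(3)[OF a, of "- 1"] by (simp add: a_inv_def)
  qed (use assms in auto)
qed (use assms in auto)

definition class_coeff :: "'g::{finite,group_add} rat_centre \<Rightarrow> 'g conj_class \<Rightarrow> rat" where
  "class_coeff z c = Poly_Mapping.lookup (Rep_rat_centre z) (SOME g. c = conj_class_of g)"

text \<open>
  A central element \<open>z\<close> acts on functionals as the transpose of its invariant
  vector field, the rational combination of the \<open>inv_derivation d\<close> with the
  coefficients of \<open>z\<close>.
\<close>

definition vector_act ::
    "'g::{finite,group_add} rat_centre \<Rightarrow> ('g class_poly \<Rightarrow> rat) \<Rightarrow> 'g class_poly \<Rightarrow> rat" where
  "vector_act z f = (\<lambda>a. \<Sum>d\<in>UNIV. class_coeff z d * f (inv_derivation d a))"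

definition word_act ::
    "'g::{finite,group_add} rat_centre free_word \<Rightarrow> ('g class_poly \<Rightarrow> rat) \<Rightarrow> 'g class_poly \<Rightarrow> rat" where
  "word_act w = foldr vector_act (letters w)"

definition free_act ::
    "('g::{finite,group_add} rat_centre free_word \<Rightarrow>\<^sub>0 rat) \<Rightarrow> ('g class_poly \<Rightarrow> rat) \<Rightarrow> 'g class_poly \<Rightarrow> rat" where
  "free_act p f = (\<Sum>w\<in>Poly_Mapping.keys p. (\<lambda>_. Poly_Mapping.lookup p w) * word_act w f)"

lemma class_coeff_centre_class: "class_coeff (centre_class d) c = (if c = d then 1 else 0)"
proof -
  have "c = conj_class_of (SOME g. c = conj_class_of g)"
    by (rule someI_ex) (rule conj_class_of_surj)
  then show ?thesis by (simp add: class_coeff_def centre_class.rep_eq lookup_class_sum)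
qed

lemma class_coeff_add: "class_coeff (x + y) c = class_coeff x c + class_coeff y c"
  by (simp add: class_coeff_def plus_rat_centre.rep_eq lookup_add)

lemma class_coeff_scaleQ: "class_coeff (k *\<^sub>Q x) c = k * class_coeff x c"
  by (simp add: class_coeff_def scaleQ_rat_centre.rep_eq lookup_single_mult_left)

lemma vector_act_centre_class: "vector_act (centre_class d) f = (\<lambda>a. f (inv_derivation d a))"
proof
  fix a
  have "vector_act (centre_class d) f a = (\<Sum>c\<in>UNIV. if c = d then f (inv_derivation c a) else 0)"
    unfolding vector_act_def by (intro sum.cong) (auto simp: class_coeff_centre_class)
  then show "vector_act (centre_class d) f a = f (inv_derivation d a)" by simp
qed

lemma vector_act_linear:
  "vector_act z (f + g) = vector_act z f + vector_act z g"
  "vector_act z ((\<lambda>_. k) * f) = (\<lambda>_. k) * vector_act z f"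
  by (simp_all add: vector_act_def fun_eq_iff algebra_simps sum.distrib sum_distrib_left)

lemma vector_act_commute: "vector_act x (vector_act y f) = vector_act y (vector_act x f)"
proof
  fix a
  have "vector_act x (vector_act y f) a
      = (\<Sum>d\<in>UNIV. \<Sum>e\<in>UNIV. class_coeff x d * (class_coeff y e * f (inv_derivation e (inv_derivation d a))))"
    by (simp add: vector_act_def sum_distrib_left)
  also have "\<dots> = (\<Sum>e\<in>UNIV. \<Sum>d\<in>UNIV. class_coeff x d * (class_coeff y e * f (inv_derivation e (inv_derivation d a))))"
    by (rule sum.swap)
  also have "\<dots> = (\<Sum>e\<in>UNIV. \<Sum>d\<in>UNIV. class_coeff y e * (class_coeff x d * f (inv_derivation d (inv_derivation e a))))"
    by (intro sum.cong refl) (simp add: inv_derivation_commute mult.left_commute)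
  also have "\<dots> = vector_act y (vector_act x f) a"
    by (simp add: vector_act_def sum_distrib_left)
  finally show "vector_act x (vector_act y f) a = vector_act y (vector_act x f) a" .
qed

lemma word_act_linear:
  "word_act w (f + g) = word_act w f + word_act w g"
  "word_act w ((\<lambda>_. k) * f) = (\<lambda>_. k) * word_act w f"
proof -
  have "foldr vector_act ws (f + g) = foldr vector_act ws f + foldr vector_act ws g" for ws
    by (induction ws) (simp_all only: foldr.simps comp_apply id_apply vector_act_linear)
  moreover have "foldr vector_act ws ((\<lambda>_. k) * f) = (\<lambda>_. k) * foldr vector_act ws f" for ws
    by (induction ws) (simp_all only: foldr.simps comp_apply id_apply vector_act_linear)
  ultimately show "word_act w (f + g) = word_act w f + word_act w g"
    and "word_act w ((\<lambda>_. k) * f) = (\<lambda>_. k) * word_act w f"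
    by (simp_all add: word_act_def)
qed

lemma word_act_add: "word_act (u + v) f = word_act u (word_act v f)"
  by (simp add: word_act_def plus_free_word_def)

lemma additive_free_act: "additive (\<lambda>p. free_act p f)"
proof -
  have "free_act (p + q) f = free_act p f + free_act q f" for p q
    unfolding free_act_def
    by (rule setsum_keys_plus_distrib) (simp_all add: fun_eq_iff algebra_simps)
  then show ?thesis by (simp add: additive_def)
qed

lemma free_act_single: "free_act (Poly_Mapping.single w k) f = (\<lambda>_. k) * word_act w f"
  by (cases "k = 0") (simp_all add: free_act_def fun_eq_iff)

lemma additive_free_act_right: "additive (free_act p)"
  by (simp add: additive_def free_act_def word_act_linear algebra_simps sum.distrib)

lemma free_act_mult: "free_act (p * q) f = free_act p (free_act q f)"
proof -
  have l: "additive (\<lambda>p. free_act (p * q) f)" "additive (\<lambda>p. free_act p (free_act q f))"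
    and r: "additive (\<lambda>q. free_act (p * q) f)" "additive (\<lambda>q. free_act p (free_act q f))" for p q
    by (simp_all add: additive_def additive.add[OF additive_free_act]
        additive.add[OF additive_free_act_right] algebra_simps)
  show ?thesis
    by (rule additive_eqI[OF l], rule additive_eqI[OF r])
      (simp add: mult_single free_act_single word_act_add word_act_linear(2) fun_eq_iff mult.assoc)
qed

lemma free_act_free_gen: "free_act (free_gen x) f = vector_act x f"
  by (simp add: free_gen_def free_act_single word_act_def fun_eq_iff)

text \<open>
  The elements of the free algebra that act as zero form a two-sided ideal, and it contains
  the relators because the action of a vector is linear in it and the vector fields commute.
\<close>

lemma free_act_env_ideal:
  assumes "p \<in> env_ideal"
  shows "free_act p f = 0"
proof -
  let ?S = "{p. \<forall>f. free_act p f = (0 :: 'a class_poly \<Rightarrow> rat)}"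
  have "ideal ?S ring_of_type_algebra"
    by (rule ideal_type_algebraI)
      (auto simp: additive.zero[OF additive_free_act] additive.add[OF additive_free_act]
        free_act_mult additive.zero[OF additive_free_act_right])
  moreover have "env_relators \<subseteq> ?S"
  proof -
    have scalar: "free_act (Poly_Mapping.single 0 k) f = (\<lambda>_. k) * f" for k and f :: "'a class_poly \<Rightarrow> rat"
      by (simp add: free_act_single word_act_def zero_free_word_def)
    have zero: "vector_act (lie_bracket x y) f = 0" for x y and f :: "'a class_poly \<Rightarrow> rat"
      by (simp add: vector_act_def lie_bracket_rat_centre_def class_coeff_def zero_rat_centre.rep_eq fun_eq_iff)
    have "vector_act (x + y) f - vector_act x f - vector_act y f = 0" for x y and f :: "'a class_poly \<Rightarrow> rat"
      by (simp add: vector_act_def class_coeff_add algebra_simps sum.distrib fun_eq_iff)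
    moreover have "vector_act (k *\<^sub>Q x) f - (\<lambda>_. k) * vector_act x f = 0" for k x and f :: "'a class_poly \<Rightarrow> rat"
      by (simp add: vector_act_def class_coeff_scaleQ fun_eq_iff sum_distrib_left mult.assoc)
    ultimately show ?thesis
      by (auto simp: env_relators_def additive.diff[OF additive_free_act] free_act_mult
          free_act_free_gen scalar zero vector_act_commute[of _ _ "_ :: 'a class_poly \<Rightarrow> rat"])
  qed
  ultimately have "env_ideal \<subseteq> ?S"
    unfolding env_ideal_def by (rule ring.genideal_minimal[OF ring_ring_of_type_algebra])
  then show ?thesis using assms by auto
qed

lift_definition env_act ::
    "'g::{finite,group_add} rat_centre enveloping \<Rightarrow> ('g class_poly \<Rightarrow> rat) \<Rightarrow> 'g class_poly \<Rightarrow> rat"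
  is free_act
proof
  fix p q :: "'g rat_centre free_word \<Rightarrow>\<^sub>0 rat" and f
  assume "p - q \<in> env_ideal"
  then have "free_act (p - q) f = 0" by (rule free_act_env_ideal)
  then show "free_act p f = free_act q f" by (simp add: additive.diff[OF additive_free_act])
qed

lemma additive_env_act: "additive (\<lambda>u. env_act u f)"
proof -
  have "env_act (u + v) f = env_act u f + env_act v f" for u v
    by transfer (rule additive.add[OF additive_free_act])
  then show ?thesis by (simp add: additive_def)
qed

lemma env_act_one: "env_act 1 f = f"
proof -
  have "word_act 0 f = f"
    by (simp add: word_act_def zero_free_word_def)
  then have "free_act 1 f = f"
    using free_act_single[of 0 1 f] by (simp add: fun_eq_iff)
  then show ?thesis by transfer
qed

lemma env_act_env_incl_mult: "env_act (env_incl z * u) f = vector_act z (env_act u f)"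
  by transfer (simp add: free_act_mult free_act_free_gen)

text \<open>
  Acting on the counit turns multiplication by \<open>env_incl (centre_class d)\<close> into
  composition with \<open>inv_derivation d\<close>, so both sides obey one recursion. The
  functionals are rational-valued because the enveloping algebra contains scalars from
  \<open>\<rat>\<close>.
\<close>

lemma env_act_weighted_basis:
  "env_act (weighted_basis N) (\<lambda>a. of_int (counit a)) = (\<lambda>a. of_int (coord_fun N a))"
proof (rule inv_deriv_unique[where p = "\<lambda>d f. (\<lambda>a. f (inv_derivation d a))"])
  let ?act = "\<lambda>u. env_act u (\<lambda>a. of_int (counit a))"
  have of_int: "additive (\<lambda>f a. of_int (f a) :: rat)"
    by (simp add: additive_def fun_eq_iff)
  show "inv_deriv d (\<lambda>N. ?act (weighted_basis N)) N = (\<lambda>a. ?act (weighted_basis N) (inv_derivation d a))" for d N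
    by (simp only: additive_inv_deriv_comp[OF additive_env_act, symmetric] inv_deriv_weighted_basis
        env_act_env_incl_mult vector_act_centre_class)
  show "inv_deriv d (\<lambda>N a. of_int (coord_fun N a)) N = (\<lambda>a. of_int (coord_fun N (inv_derivation d a)) :: rat)" for d N
    by (simp only: additive_inv_deriv_comp[OF of_int, symmetric] inv_deriv_coord_fun)
  show "?act (weighted_basis 0) = (\<lambda>a. of_int (coord_fun 0 a))"
    by (simp only: weighted_basis_0 env_act_one coord_fun_0)
  show "x = y" if "of_nat (Suc n) * x = of_nat (Suc n) * y" for n and x y :: "'a class_poly \<Rightarrow> rat"
    using that by (simp add: fun_eq_iff del: of_nat_Suc)
qed

text \<open>
  The action on the counit recovers the functional, hence its coefficients, from the
  combination.
\<close>

lemma inj_weighted_comb: "inj weighted_comb"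
proof (rule injI)
  fix F G :: "'a class_poly"
  let ?act = "\<lambda>u. env_act u (\<lambda>a. of_int (counit a))"
  have of_int: "additive (\<lambda>f a. of_int (f a) :: rat)"
    by (simp add: additive_def fun_eq_iff)
  have act: "?act (weighted_comb F) = (\<lambda>a. of_int (functional F a))" for F :: "'a class_poly"
    by (simp only: weighted_comb_def additive_comp_lincomb[OF additive_env_act] env_act_weighted_basis
        functional_def additive_comp_lincomb[OF of_int])
  assume "weighted_comb F = weighted_comb G"
  then have "(\<lambda>a. of_int (functional F a) :: rat) = (\<lambda>a. of_int (functional G a))"
    by (simp only: act[symmetric])
  then have "functional F = functional G" by (simp add: fun_eq_iff)
  then show "F = G" by (rule injD[OF inj_functional])
qed

section \<open>The isomorphism\<close>

lemma carrier_weighted_ivp_ring: "carrier weighted_ivp_ring = range weighted_comb"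
proof (intro Set.set_eqI iffI)
  fix u :: "'a rat_centre enveloping"
  assume "u \<in> carrier weighted_ivp_ring"
  then obtain S :: "('a conj_class \<Rightarrow>\<^sub>0 nat) set" and k where "finite S"
    and u: "u = (\<Sum>N\<in>S. of_int (k N) * weighted_basis N)"
    by (auto simp: weighted_ivp_ring_def)
  have "u = weighted_comb (\<Sum>N\<in>S. Poly_Mapping.single N (k N))"
    unfolding u weighted_comb_def by (simp add: additive.sum[OF additive_lincomb] lincomb_single)
  then show "u \<in> range weighted_comb" by blast
next
  fix u :: "'a rat_centre enveloping"
  assume "u \<in> range weighted_comb"
  then obtain F where "u = weighted_comb F" by auto
  then have "u = (\<Sum>N\<in>Poly_Mapping.keys F. of_int (Poly_Mapping.lookup F N) * weighted_basis N)"
    by (simp add: weighted_comb_def lincomb_def)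
  moreover have "finite (Poly_Mapping.keys F)" by (rule finite_keys)
  ultimately show "u \<in> carrier weighted_ivp_ring"
    unfolding weighted_ivp_ring_def by auto
qed

lemma weighted_comb_one: "weighted_comb 1 = 1"
  using weighted_comb_single[of 0] by (simp add: weighted_basis_0)

lemma ring_weighted_ivp_ring: "ring (weighted_ivp_ring :: 'g::{finite,group_add} rat_centre enveloping ring)"
proof -
  let ?U = "ring_of_type_algebra :: 'g rat_centre enveloping ring"
  interpret ring ?U by (rule ring_ring_of_type_algebra)
  have "subring (range weighted_comb) ?U"
  proof (rule subringI)
    show "\<one>\<^bsub>?U\<^esub> \<in> range weighted_comb"
      by (simp add: weighted_comb_one[symmetric])
  next
    fix u :: "'g rat_centre enveloping" assume "u \<in> range weighted_comb"
    then obtain F where u: "u = weighted_comb F" by auto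
    have "\<ominus>\<^bsub>?U\<^esub> u = - u" by (rule minus_equality) simp_all
    then show "\<ominus>\<^bsub>?U\<^esub> u \<in> range weighted_comb"
      by (simp only: u additive.minus[OF additive_weighted_comb, symmetric] rangeI)
  next
    fix u v :: "'g rat_centre enveloping"
    assume "u \<in> range weighted_comb" "v \<in> range weighted_comb"
    then obtain F G where uv: "u = weighted_comb F" "v = weighted_comb G" by auto
    show "u \<otimes>\<^bsub>?U\<^esub> v \<in> range weighted_comb"
      using weighted_comb_convolution[of F G] unfolding uv by (metis rangeI ring_of_type_algebra_simps(2))
    show "u \<oplus>\<^bsub>?U\<^esub> v \<in> range weighted_comb"
      by (simp add: uv additive.add[OF additive_weighted_comb, symmetric])
  qed simp
  then have "ring (?U\<lparr>carrier := range weighted_comb\<rparr>)" by (rule subring_is_ring)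
  moreover have "weighted_ivp_ring = ?U\<lparr>carrier := range weighted_comb\<rparr>"
    using carrier_weighted_ivp_ring[where 'a = 'g] by (simp add: weighted_ivp_ring_def)
  ultimately show ?thesis by simp
qed

lemma weighted_ivp_ring_simps:
  "u \<otimes>\<^bsub>weighted_ivp_ring\<^esub> v = u * v" "u \<oplus>\<^bsub>weighted_ivp_ring\<^esub> v = u + v"
  "\<one>\<^bsub>weighted_ivp_ring\<^esub> = 1" "\<zero>\<^bsub>weighted_ivp_ring\<^esub> = 0"
  by (simp_all add: weighted_ivp_ring_def ring_of_type_algebra_def)

lemma distribution_algebra_simps:
  "f \<otimes>\<^bsub>distribution_algebra\<^esub> g = convolution f g" "f \<oplus>\<^bsub>distribution_algebra\<^esub> g = f + g"
  "\<one>\<^bsub>distribution_algebra\<^esub> = counit" "\<zero>\<^bsub>distribution_algebra\<^esub> = 0"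
  by (simp_all add: distribution_algebra_def convolution_def fun_eq_iff)

text \<open>
  This direction lets the ring axioms be transported from the subring of the enveloping
  algebra to the distribution algebra.
\<close>

lemma functional_iso:
  "(\<lambda>u. functional (inv_into UNIV weighted_comb u)) \<in> ring_iso weighted_ivp_ring distribution_algebra"
proof (rule ring_iso_memI)
  let ?h = "\<lambda>u. functional (inv_into UNIV weighted_comb u)"
  have h: "?h (weighted_comb F) = functional F" for F :: "'a class_poly"
    by (simp add: inv_f_f[OF inj_weighted_comb])
  show "?h u \<in> carrier distribution_algebra" for u :: "'a rat_centre enveloping"
    by (simp add: carrier_distribution_algebra)
  show "?h (u \<otimes>\<^bsub>weighted_ivp_ring\<^esub> v) = ?h u \<otimes>\<^bsub>distribution_algebra\<^esub> ?h v"
    if u: "u \<in> carrier weighted_ivp_ring" and v: "v \<in> carrier weighted_ivp_ring"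
    for u v :: "'a rat_centre enveloping"
  proof -
    obtain F G where uv: "u = weighted_comb F" "v = weighted_comb G"
      using u v by (auto simp: carrier_weighted_ivp_ring)
    obtain H where "functional H = convolution (functional F) (functional G)"
      "weighted_comb H = weighted_comb F * weighted_comb G"
      using weighted_comb_convolution by blast
    then show ?thesis
      by (simp only: uv weighted_ivp_ring_simps distribution_algebra_simps h) (metis h)
  qed
  show "?h (u \<oplus>\<^bsub>weighted_ivp_ring\<^esub> v) = ?h u \<oplus>\<^bsub>distribution_algebra\<^esub> ?h v"
    if u: "u \<in> carrier weighted_ivp_ring" and v: "v \<in> carrier weighted_ivp_ring"
    for u v :: "'a rat_centre enveloping"
  proof -
    obtain F G where uv: "u = weighted_comb F" "v = weighted_comb G"
      using u v by (auto simp: carrier_weighted_ivp_ring)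
    show ?thesis
      by (simp only: uv weighted_ivp_ring_simps distribution_algebra_simps h
          additive.add[OF additive_weighted_comb, symmetric] additive.add[OF additive_functional, symmetric])
  qed
  have "functional 1 = (counit :: 'a class_poly \<Rightarrow> int)"
    using functional_single[of 0] by (simp add: coord_fun_0)
  then show "?h \<one>\<^bsub>weighted_ivp_ring\<^esub> = (\<one>\<^bsub>distribution_algebra\<^esub> :: 'a class_poly \<Rightarrow> int)"
    by (simp only: weighted_ivp_ring_simps distribution_algebra_simps weighted_comb_one[symmetric] h)
  show "bij_betw ?h (carrier (weighted_ivp_ring :: 'a rat_centre enveloping ring)) (carrier distribution_algebra)"
    unfolding carrier_weighted_ivp_ring carrier_distribution_algebra
  proof (rule bij_betw_imageI)
    show "inj_on ?h (range (weighted_comb :: 'a class_poly \<Rightarrow> _))"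
    proof (rule inj_onI, elim rangeE)
      fix u v :: "'a rat_centre enveloping" and F G
      assume "?h u = ?h v" "u = weighted_comb F" "v = weighted_comb G"
      moreover from this have "functional F = functional G" by (simp only: h)
      then have "F = G" by (rule injD[OF inj_functional])
      ultimately show "u = v" by simp
    qed
    show "?h ` range (weighted_comb :: 'a class_poly \<Rightarrow> _) = range functional"
      by (simp add: image_image h)
  qed
qed

theorem theoremA5:
  shows "ring (distribution_algebra :: ('g::{finite,group_add} class_poly \<Rightarrow> int) ring)
    \<and> ring (weighted_ivp_ring :: 'g rat_centre enveloping ring)
    \<and> (distribution_algebra :: ('g class_poly \<Rightarrow> int) ring) \<simeq> (weighted_ivp_ring :: 'g rat_centre enveloping ring)"
proof (intro conjI)
  let ?D = "distribution_algebra :: ('g class_poly \<Rightarrow> int) ring"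
  let ?W = "weighted_ivp_ring :: 'g rat_centre enveloping ring"
  let ?h = "\<lambda>u. functional (inv_into UNIV weighted_comb u) :: 'g class_poly \<Rightarrow> int"
  show W: "ring ?W" by (rule ring_weighted_ivp_ring)
  have "?h \<zero>\<^bsub>?W\<^esub> = \<zero>\<^bsub>?D\<^esub>"
    using inv_f_f[OF inj_weighted_comb, of "0 :: 'g class_poly"]
    by (simp add: weighted_ivp_ring_simps distribution_algebra_simps
        additive.zero[OF additive_functional] additive.zero[OF additive_weighted_comb])
  then show "ring ?D"
    using ring.ring_iso_imp_img_ring[OF W functional_iso] by simp
  show "?D \<simeq> ?W"
    using ring_iso_set_sym[OF W functional_iso] by (auto simp: is_ring_iso_def)
qed

end
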